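(* Let $m,n$ be positive integers. If $m>2$, then \[\rho(C_m,P_n)=\begin{cases}\frac{n+1}{m} & \text{if } n\le m-1,\\[2pt] \frac{n}{m-1} & \text{if } n\ge m-1,\end{cases}\] and if $n>1$, then \[\rho(P_m,C_{2n})=\frac{2n}{m}.\]
   Context: $P_\ell$ denotes the path with $\ell$ edges and $C_\ell$ the cycle with $\ell$ edges. A graphon is a symmetric measurable function $W:[0,1]^2\to[0,1]$. For a finite simple graph $G$ with vertices $v_1,\dots,v_n$, put $t(G,W)=\int_{[0,1]^n}\prod_{v_iv_j\in E(G)}W(x_i,x_j)\,dx_1\cdots dx_n$; for a finite graph $W$ (loops allowed), $t(G,W)=\hom(G,W)/|V(W)|^{|V(G)|}$, where $\hom(G,W)$ is the number of maps $V(G)\to V(W)$ sending edges to edges. For finite simple graphs $G,H$, the density domination exponent is $\rho(G,H)=\sup_W \frac{\log t(H,W)}{\log t(G,W)}\in[0,\infty]$, where $W$ ranges over all graphons (equivalently, all finite graphs) with $t(G,W)\ne 0$. Conventions: those $W$ with $t(G,W)=1$, where the quotient is undefined, are omitted; $\log 0=-\infty$, so the quotient is $+\infty$ if $t(H,W)=0$. Thus, when $G$ has at least one edge, for $c>0$ one has $\rho(G,H)\le c$ if and only if $t(H,W)\ge t(G,W)^c$ for every $W$. *)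

theory Defs
  imports "HOL-Analysis.Analysis"
begin

text \<open>A finite simple graph is a pair of a finite vertex set and a set of two-element
  vertex sets.\<close>

type_synonym graph = "nat set \<times> nat set set"

definition simple_graph :: "graph \<Rightarrow> bool" where
  "simple_graph G \<longleftrightarrow> finite (fst G) \<and> (\<forall>e \<in> snd G. e \<subseteq> fst G \<and> card e = 2)"

text \<open>Paths and cycles are indexed by their number of edges.  Cycles are meant for \<open>l \<ge> 3\<close>; smaller
  \<open>l\<close> give degenerate values.\<close>

definition path_graph :: "nat \<Rightarrow> graph" where
  "path_graph l = ({..l}, (\<lambda>i. {i, Suc i}) ` {..<l})"

definition cycle_graph :: "nat \<Rightarrow> graph" where
  "cycle_graph l = ({..<l}, (\<lambda>i. {i, Suc i mod l}) ` {..<l})"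

lemma simple_graph_path: "simple_graph (path_graph l)"
  by (auto simp: simple_graph_def path_graph_def)

lemma card_edges_path: "card (snd (path_graph l)) = l"
proof -
  have "inj_on (\<lambda>i. {i, Suc i}) {..<l}"
    by (auto simp: inj_on_def doubleton_eq_iff)
  then show ?thesis by (simp add: path_graph_def card_image)
qed

lemma simple_graph_cycle:
  assumes "l \<ge> 3"
  shows "simple_graph (cycle_graph l)"
proof -
  have "i \<noteq> Suc i mod l" if "i < l" for i
    using that assms by (cases "Suc i = l") auto
  then show ?thesis
    using assms by (auto simp: simple_graph_def cycle_graph_def card_2_iff)
qed

lemma card_edges_cycle:
  assumes "l \<ge> 3"
  shows "card (snd (cycle_graph l)) = l"
proof -
  have "inj_on (\<lambda>i. {i, Suc i mod l}) {..<l}"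
    using assms by (auto simp: inj_on_def doubleton_eq_iff mod_Suc split: if_splits)
  then show ?thesis by (simp add: cycle_graph_def card_image)
qed

abbreviation unit_interval :: "real measure" where
  "unit_interval \<equiv> restrict_space lborel {0..1}"

text \<open>Values of \<open>W\<close> outside the unit square are irrelevant.  Measurable means Borel measurable;
  every Lebesgue measurable graphon agrees almost everywhere with a Borel measurable one.\<close>

definition graphon :: "(real \<Rightarrow> real \<Rightarrow> real) \<Rightarrow> bool" where
  "graphon W \<longleftrightarrow>
     (\<lambda>(x, y). W x y) \<in> borel_measurable (unit_interval \<Otimes>\<^sub>M unit_interval) \<and>
     (\<forall>x\<in>{0..1}. \<forall>y\<in>{0..1}. W x y = W y x \<and> 0 \<le> W x y \<and> W x y \<le> 1)"

text \<open>The endpoints of an edge \<open>e\<close> are \<open>Min e\<close> and \<open>Max e\<close>, so each unordered edge contributes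
  exactly one factor; their order does not matter because \<open>W\<close> is symmetric.\<close>

definition hom_density :: "graph \<Rightarrow> (real \<Rightarrow> real \<Rightarrow> real) \<Rightarrow> real" where
  "hom_density G W =
     (LINT x | PiM (fst G) (\<lambda>_. unit_interval). (\<Prod>e\<in>snd G. W (x (Min e)) (x (Max e))))"

text \<open>Densities lie in the unit interval, so the real quotient below is nonnegative and the
  embedding into \<^typ>\<open>ennreal\<close> does not truncate it.\<close>

definition log_density_ratio :: "graph \<Rightarrow> graph \<Rightarrow> (real \<Rightarrow> real \<Rightarrow> real) \<Rightarrow> ennreal" where
  "log_density_ratio G H W =
     (if hom_density H W = 0 then \<infinity>
      else ennreal (ln (hom_density H W) / ln (hom_density G W)))"

definition density_domination_exponent :: "graph \<Rightarrow> graph \<Rightarrow> ennreal" where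
  "density_domination_exponent G H =
     (SUP W \<in> {W. graphon W \<and> hom_density G W \<noteq> 0 \<and> hom_density G W \<noteq> 1}.
        log_density_ratio G H W)"

end

theory Submission
  imports Defs "HOL-Probability.Probability"
begin

text \<open>
  The upper bounds come from entropy.  Take a random homomorphic copy of \<open>C\<^sub>m\<close> in \<open>W\<close>; by rotation
  and reflection all its edges have the same symmetric distribution, so a Markov chain with this
  edge distribution produces random walks of any length \<open>n\<close>, and by Jensen's inequality the entropy
  of this chain is a lower bound for \<open>ln t(P\<^sub>n, W)\<close>.  This bound is affine in \<open>n\<close>.  At \<open>n = m - 1\<close> it is
  at least \<open>ln t(C\<^sub>m, W)\<close>, because the Markov chain maximises entropy for given edge marginals, and
  at \<open>n = 0\<close> it is the entropy of one vertex, which is at least \<open>ln t(C\<^sub>m, W) / m\<close> by subadditivity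
  and at most \<open>0\<close>.  Interpolation gives the exponent for \<open>n \<le> m - 1\<close>, extrapolation the one for
  \<open>n \<ge> m - 1\<close>.  For even cycles, \<open>t(P\<^sub>m, W)\<^sup>n \<le> t(P\<^sub>m\<^sub>n, W)\<close> (the same chain argument applied to the
  \<open>m\<close>-step kernel), and \<open>t(P\<^sub>m\<^sub>n, W)\<^sup>2 \<le> t(C\<^sub>2\<^sub>n, W)\<^sup>m\<close> since the Hilbert--Schmidt norm is
  submultiplicative.  All logarithms are finite once \<open>W\<close> is replaced by \<open>max W \<delta>\<close>, and \<open>\<delta>\<close>
  tends to \<open>0\<close> at the end.  The bounds are attained by a clique on half of the vertices, by two
  disjoint cliques, and by a constant graphon, respectively.
\<close>

section \<open>Bounded measurable functions\<close>

text \<open>On a probability space these functions are integrable, and the class is closed under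
  products, substitution and partial integration. All integrability and Fubini side conditions below
  reduce to such closure rules.\<close>

definition bmeas :: "'a measure \<Rightarrow> ('a \<Rightarrow> real) \<Rightarrow> bool" where
  "bmeas M f \<longleftrightarrow> f \<in> borel_measurable M \<and> (\<exists>B. \<forall>x\<in>space M. \<bar>f x\<bar> \<le> B)"

lemma bmeasI:
  assumes "f \<in> borel_measurable M" "\<And>x. x \<in> space M \<Longrightarrow> \<bar>f x\<bar> \<le> B"
  shows "bmeas M f"
  using assms unfolding bmeas_def by blast

lemma bmeas_measurable[measurable_dest]: "bmeas M f \<Longrightarrow> f \<in> borel_measurable M"
  by (simp add: bmeas_def)

lemma bmeas_const: "bmeas M (\<lambda>_. c)"
  by (rule bmeasI[of _ _ "\<bar>c\<bar>"]) auto

lemma bmeas_add: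
  assumes "bmeas M f" "bmeas M g"
  shows "bmeas M (\<lambda>x. f x + g x)"
proof -
  obtain A B where "\<And>x. x \<in> space M \<Longrightarrow> \<bar>f x\<bar> \<le> A" "\<And>x. x \<in> space M \<Longrightarrow> \<bar>g x\<bar> \<le> B"
    using assms unfolding bmeas_def by blast
  then show ?thesis
    using assms by (intro bmeasI[of _ _ "A + B"]) (auto intro!: order_trans[OF abs_triangle_ineq] add_mono)
qed

lemma bmeas_mult:
  assumes "bmeas M f" "bmeas M g"
  shows "bmeas M (\<lambda>x. f x * g x)"
proof -
  obtain A B where AB: "\<And>x. x \<in> space M \<Longrightarrow> \<bar>f x\<bar> \<le> A" "\<And>x. x \<in> space M \<Longrightarrow> \<bar>g x\<bar> \<le> B"
    using assms unfolding bmeas_def by blast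
  have "\<bar>f x * g x\<bar> \<le> A * B" if "x \<in> space M" for x
    unfolding abs_mult using AB[OF that] by (intro mult_mono) auto
  then show ?thesis
    using assms by (intro bmeasI[of _ _ "A * B"]) auto
qed

lemma bmeas_diff:
  assumes "bmeas M f" "bmeas M g"
  shows "bmeas M (\<lambda>x. f x - g x)"
  using bmeas_add[OF assms(1) bmeas_mult[OF bmeas_const[of _ "-1"] assms(2)]] by simp

lemma bmeas_prod:
  assumes "\<And>i. i \<in> I \<Longrightarrow> bmeas M (f i)"
  shows "bmeas M (\<lambda>x. \<Prod>i\<in>I. f i x)"
  using assms by (induction I rule: infinite_finite_induct) (auto intro: bmeas_const bmeas_mult)

text \<open>A uniform lower bound \<open>d\<close> is what keeps the logarithm bounded; mere
  positivity would not suffice.\<close>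

lemma bmeas_ln:
  assumes "bmeas M f" "0 < d" "\<And>x. x \<in> space M \<Longrightarrow> d \<le> f x"
  shows "bmeas M (\<lambda>x. ln (f x))"
proof -
  obtain B where B: "\<And>x. x \<in> space M \<Longrightarrow> \<bar>f x\<bar> \<le> B"
    using assms unfolding bmeas_def by blast
  have "\<bar>ln (f x)\<bar> \<le> \<bar>ln d\<bar> + \<bar>ln B\<bar>" if "x \<in> space M" for x
  proof -
    have "ln d \<le> ln (f x)" "ln (f x) \<le> ln B"
      using assms(2,3) B[OF that] that by force+
    then show ?thesis by linarith
  qed
  then show ?thesis
    using assms(1) by (intro bmeasI) auto
qed

lemma bmeas_divide:
  assumes "bmeas M g" "bmeas M f" "0 < d" "\<And>x. x \<in> space M \<Longrightarrow> d \<le> f x"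
  shows "bmeas M (\<lambda>x. g x / f x)"
proof -
  have "bmeas M (\<lambda>x. 1 / f x)"
  proof (rule bmeasI)
    show "\<bar>1 / f x\<bar> \<le> 1 / d" if "x \<in> space M" for x
      using assms(3) assms(4)[OF that] by (simp add: field_simps)
  qed (use assms(2) in measurable)
  from bmeas_mult[OF assms(1) this] show ?thesis by simp
qed

lemma bmeas_compose:
  assumes "bmeas M f" "g \<in> measurable N M"
  shows "bmeas N (\<lambda>x. f (g x))"
  using assms measurable_space[OF assms(2)] unfolding bmeas_def
  by (auto intro: measurable_compose)

lemma bmeas_compose2:
  assumes "bmeas (M1 \<Otimes>\<^sub>M M2) (\<lambda>(x, y). f x y)" "g \<in> measurable N M1" "h \<in> measurable N M2"
  shows "bmeas N (\<lambda>x. f (g x) (h x))"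
  using bmeas_compose[OF assms(1) measurable_Pair[OF assms(2,3)]] by simp

lemma bmeas_pairI:
  assumes "bmeas (M \<Otimes>\<^sub>M N) (\<lambda>p. f (fst p) (snd p))"
  shows "bmeas (M \<Otimes>\<^sub>M N) (\<lambda>(x, y). f x y)"
  using assms by (simp add: case_prod_beta')

section \<open>Jensen, entropy and Cauchy--Schwarz inequalities on a probability space\<close>

context prob_space
begin

lemma bmeas_integrable: "bmeas M f \<Longrightarrow> integrable M f"
  by (auto simp: bmeas_def intro!: integrable_const_bound[OF AE_I2])

lemma bmeas_integral:
  assumes "bmeas (N \<Otimes>\<^sub>M M) (\<lambda>(x, y). f x y)"
  shows "bmeas N (\<lambda>x. \<integral>y. f x y \<partial>M)"
proof -
  obtain B where B: "\<And>x y. x \<in> space N \<Longrightarrow> y \<in> space M \<Longrightarrow> \<bar>f x y\<bar> \<le> B"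
    using assms unfolding bmeas_def by (auto simp: space_pair_measure)
  have "\<bar>\<integral>y. f x y \<partial>M\<bar> \<le> B" if x: "x \<in> space N" for x
  proof -
    have i: "integrable M (\<lambda>y. f x y)"
      by (rule bmeas_integrable) (use x in \<open>intro bmeas_compose2[OF assms]\<close>, auto)
    have "\<bar>\<integral>y. f x y \<partial>M\<bar> \<le> (\<integral>y. \<bar>f x y\<bar> \<partial>M)"
      by (rule integral_abs_bound)
    also have "\<dots> \<le> (\<integral>y. B \<partial>M)"
      by (intro integral_mono) (use i B x in auto)
    finally show ?thesis by (simp add: prob_space)
  qed
  moreover have "(\<lambda>x. \<integral>y. f x y \<partial>M) \<in> borel_measurable N"
    using assms by (intro borel_measurable_lebesgue_integral) (simp add: bmeas_def)
  ultimately show ?thesis by (rule bmeasI[rotated])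
qed

lemma integral_ge_const:
  assumes "bmeas M f" "\<And>x. x \<in> space M \<Longrightarrow> (d::real) \<le> f x"
  shows "d \<le> (\<integral>x. f x \<partial>M)"
proof -
  have "(\<integral>x. d \<partial>M) \<le> (\<integral>x. f x \<partial>M)"
    by (intro integral_mono bmeas_integrable assms bmeas_const)
  then show ?thesis by (simp add: prob_space)
qed

lemma integral_le_const:
  assumes "bmeas M f" "\<And>x. x \<in> space M \<Longrightarrow> f x \<le> (d::real)"
  shows "(\<integral>x. f x \<partial>M) \<le> d"
proof -
  have "(\<integral>x. f x \<partial>M) \<le> (\<integral>x. d \<partial>M)"
    by (intro integral_mono bmeas_integrable assms bmeas_const)
  then show ?thesis by (simp add: prob_space)
qed

text \<open>\<open>ln\<close> lies below its tangent at the weighted mean \<open>s = S / P\<close>,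
  and the linear part of the tangent integrates to 0 against \<open>p\<close>. The weight
  \<open>p\<close> may have any positive mass \<open>P\<close>, which spares normalising
  distributions later.\<close>

lemma jensen_ln:
  assumes p: "bmeas M p" and u: "bmeas M u"
    and p0: "\<And>x. x \<in> space M \<Longrightarrow> 0 \<le> p x"
    and d: "0 < d" "\<And>x. x \<in> space M \<Longrightarrow> d \<le> u x"
    and P: "(\<integral>x. p x \<partial>M) = P" "0 < P"
    and S: "(\<integral>x. p x * u x \<partial>M) = S"
  shows "(\<integral>x. p x * ln (u x) \<partial>M) \<le> P * ln (S / P)"
proof -
  have "(\<integral>x. p x * d \<partial>M) \<le> S"
    unfolding S[symmetric]
    by (intro integral_mono bmeas_integrable bmeas_mult p u bmeas_const mult_left_mono p0 d)
  then have "P * d \<le> S" using P by simp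
  then have S0: "S > 0" using P d by (smt (verit) mult_pos_pos)
  define s where "s = S / P"
  have s: "s > 0" using S0 P by (simp add: s_def)
  have l: "bmeas M (\<lambda>x. ln (u x))" by (rule bmeas_ln[OF u d])
  have "(\<integral>x. p x * ln (u x) \<partial>M) \<le> (\<integral>x. p x * ln s + (1 / s) * (p x * u x) - p x \<partial>M)"
  proof (intro integral_mono bmeas_integrable bmeas_diff bmeas_add bmeas_mult p u l bmeas_const)
    fix x assume x: "x \<in> space M"
    then have ux: "u x > 0" using d by force
    then have "ln (u x / s) \<le> u x / s - 1"
      using s by (intro ln_le_minus_one) simp
    then have "ln (u x) \<le> ln s + u x / s - 1"
      using ux s by (simp add: ln_div)
    then have "p x * ln (u x) \<le> p x * (ln s + u x / s - 1)"
      using p0[OF x] by (rule mult_left_mono)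
    then show "p x * ln (u x) \<le> p x * ln s + (1 / s) * (p x * u x) - p x"
      by (simp add: algebra_simps)
  qed
  also have "\<dots> = P * ln s + (1 / s) * S - P"
    using p u by (simp add: P S bmeas_integrable bmeas_mult)
  also have "\<dots> = P * ln s"
    using S0 P by (simp add: s_def)
  finally show ?thesis by (simp add: s_def)
qed

text \<open>Jensen's inequality for \<open>u = 1 / p\<close>, whose weighted integral is the mass 1
  of the space. After normalisation of \<open>p\<close>: entropy relative to a probability measure
  is at most 0.\<close>

lemma entropy_ge:
  assumes p: "bmeas M p" and d: "0 < d" "\<And>x. x \<in> space M \<Longrightarrow> d \<le> p x"
    and P: "(\<integral>x. p x \<partial>M) = P"
  shows "P * ln P \<le> (\<integral>x. p x * ln (p x) \<partial>M)"
proof -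
  obtain C where C: "\<And>x. x \<in> space M \<Longrightarrow> \<bar>p x\<bar> \<le> C"
    using p unfolding bmeas_def by blast
  have pos: "p x > 0" if "x \<in> space M" for x using d that by force
  have "d \<le> P" using integral_ge_const[OF p d(2)] P by simp
  then have P0: "P > 0" using d by linarith
  obtain x0 where "x0 \<in> space M" using not_empty by blast
  then have C0: "C > 0" using C pos by force
  have "(\<integral>x. p x * ln (1 / p x) \<partial>M) \<le> P * ln (1 / P)"
  proof (rule jensen_ln[where d = "1 / C"])
    show "bmeas M (\<lambda>x. 1 / p x)" by (rule bmeas_divide[OF bmeas_const p d])
    show "1 / C \<le> 1 / p x" if "x \<in> space M" for x
      using C[OF that] pos[OF that] by (intro divide_left_mono) auto
    show "0 \<le> p x" if "x \<in> space M" for x using pos[OF that] by simp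
    have "(\<integral>x. p x * (1 / p x) \<partial>M) = (\<integral>x. 1 \<partial>M)"
      by (intro Bochner_Integration.integral_cong) (use pos in force)+
    then show "(\<integral>x. p x * (1 / p x) \<partial>M) = 1" by (simp add: prob_space)
  qed (use p P P0 C0 in auto)
  moreover have "(\<integral>x. p x * ln (1 / p x) \<partial>M) = (\<integral>x. - (p x * ln (p x)) \<partial>M)"
    by (intro Bochner_Integration.integral_cong) (use pos in \<open>force simp: ln_div\<close>)+
  ultimately show ?thesis using P0 by (simp add: ln_div)
qed

text \<open>The integral of the square of \<open>?g * f x - ?m * g x\<close> is nonnegative and
  equals \<open>?g * (?f * ?g - ?m\<^sup>2)\<close>; by \<open>g0\<close> the factor
  \<open>?g\<close> can be cancelled.\<close>

lemma cauchy_schwarz: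
  assumes f: "bmeas M f" and g: "bmeas M g" and g0: "0 < (\<integral>x. (g x)\<^sup>2 \<partial>M)"
  shows "(\<integral>x. f x * g x \<partial>M)\<^sup>2 \<le> (\<integral>x. (f x)\<^sup>2 \<partial>M) * (\<integral>x. (g x)\<^sup>2 \<partial>M)"
proof -
  let ?f = "\<integral>x. (f x)\<^sup>2 \<partial>M" and ?g = "\<integral>x. (g x)\<^sup>2 \<partial>M" and ?m = "\<integral>x. f x * g x \<partial>M"
  have i: "integrable M (\<lambda>x. (f x)\<^sup>2)" "integrable M (\<lambda>x. (g x)\<^sup>2)" "integrable M (\<lambda>x. f x * g x)"
    using f g by (simp_all add: power2_eq_square bmeas_integrable bmeas_mult)
  have "0 \<le> (\<integral>x. (?g * f x - ?m * g x)\<^sup>2 \<partial>M)"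
    by (intro integral_nonneg_AE) simp
  also have "\<dots> = (\<integral>x. ?g\<^sup>2 * (f x)\<^sup>2 - 2 * ?g * ?m * (f x * g x) + ?m\<^sup>2 * (g x)\<^sup>2 \<partial>M)"
    by (intro Bochner_Integration.integral_cong) (simp_all add: power2_eq_square algebra_simps)
  also have "\<dots> = ?g\<^sup>2 * ?f - 2 * ?g * ?m * ?m + ?m\<^sup>2 * ?g"
    using i by simp
  also have "\<dots> = ?g * (?f * ?g - ?m\<^sup>2)"
    by (simp add: power2_eq_square algebra_simps)
  finally show ?thesis using g0 by (simp add: zero_le_mult_iff)
qed

end

section \<open>Fubini's theorem for bounded measurable functions\<close>

lemma (in prob_space) prob_space_pair_self: "prob_space (M \<Otimes>\<^sub>M M)"
  by (intro prob_space_pair prob_space_axioms)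

lemma integral_pair_fst:
  assumes "prob_space M" "prob_space N" "bmeas (M \<Otimes>\<^sub>M N) (\<lambda>(x, y). f x y)"
  shows "(\<integral>p. (case p of (x, y) \<Rightarrow> f x y) \<partial>(M \<Otimes>\<^sub>M N)) = (\<integral>x. \<integral>y. f x y \<partial>N \<partial>M)"
proof -
  interpret pair_prob_space M N
    using assms by (simp add: pair_prob_space_def pair_sigma_finite_def prob_space_imp_sigma_finite)
  have "integrable (M \<Otimes>\<^sub>M N) (\<lambda>(x, y). f x y)"
    by (rule prob_space.bmeas_integrable[OF prob_space_axioms assms(3)])
  from integral_fst'[OF this] show ?thesis by simp
qed

lemma integral_pair_snd:
  assumes "prob_space M" "prob_space N" "bmeas (M \<Otimes>\<^sub>M N) (\<lambda>(x, y). f x y)"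
  shows "(\<integral>p. (case p of (x, y) \<Rightarrow> f x y) \<partial>(M \<Otimes>\<^sub>M N)) = (\<integral>y. \<integral>x. f x y \<partial>M \<partial>N)"
proof -
  interpret pair_prob_space M N
    using assms by (simp add: pair_prob_space_def pair_sigma_finite_def prob_space_imp_sigma_finite)
  have "integrable (M \<Otimes>\<^sub>M N) (\<lambda>(x, y). f x y)"
    by (rule prob_space.bmeas_integrable[OF prob_space_axioms assms(3)])
  from integral_snd[OF this] show ?thesis by simp
qed

lemma (in prob_space) integral_swap:
  assumes "bmeas (M \<Otimes>\<^sub>M M) (\<lambda>(x, y). f x y)"
  shows "(\<integral>x. \<integral>y. f x y \<partial>M \<partial>M) = (\<integral>y. \<integral>x. f x y \<partial>M \<partial>M)"
  using integral_pair_fst[OF prob_space_axioms prob_space_axioms assms]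
    integral_pair_snd[OF prob_space_axioms prob_space_axioms assms] by simp


section \<open>Powers of a symmetric kernel\<close>

text \<open>\<open>kpow M K j\<close> is the kernel of \<open>(j + 1)\<close>-step walks, whereas \<open>walk M K n x\<close> counts
  \<open>n\<close>-step walks from \<open>x\<close>.\<close>

primrec kpow :: "'a measure \<Rightarrow> ('a \<Rightarrow> 'a \<Rightarrow> real) \<Rightarrow> nat \<Rightarrow> 'a \<Rightarrow> 'a \<Rightarrow> real" where
  "kpow M K 0 = K"
| "kpow M K (Suc j) = (\<lambda>x y. \<integral>z. K x z * kpow M K j z y \<partial>M)"

primrec walk :: "'a measure \<Rightarrow> ('a \<Rightarrow> 'a \<Rightarrow> real) \<Rightarrow> nat \<Rightarrow> 'a \<Rightarrow> real" where
  "walk M K 0 = (\<lambda>_. 1)"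
| "walk M K (Suc n) = (\<lambda>x. \<integral>y. K x y * walk M K n y \<partial>M)"

text \<open>The lower bound \<open>d\<close> passes to all powers and walk counts (as a power of
  \<open>d\<close>), so every logarithm and quotient below is bounded. General graphons are
  approximated by such kernels later.\<close>

locale kernel = prob_space M for M :: "'a measure" +
  fixes K :: "'a \<Rightarrow> 'a \<Rightarrow> real" and d :: real
  assumes K_measurable: "(\<lambda>(x, y). K x y) \<in> borel_measurable (M \<Otimes>\<^sub>M M)"
    and d_pos: "0 < d"
    and K_ge: "x \<in> space M \<Longrightarrow> y \<in> space M \<Longrightarrow> d \<le> K x y"
    and K_le: "x \<in> space M \<Longrightarrow> y \<in> space M \<Longrightarrow> K x y \<le> 1"
    and K_sym: "x \<in> space M \<Longrightarrow> y \<in> space M \<Longrightarrow> K x y = K y x"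
begin

lemma K_pos: "x \<in> space M \<Longrightarrow> y \<in> space M \<Longrightarrow> 0 < K x y"
  using K_ge d_pos by force

lemma bmeas_K: "bmeas (M \<Otimes>\<^sub>M M) (\<lambda>(x, y). K x y)"
  using K_measurable K_pos K_le
  by (intro bmeasI[of _ _ 1]) (auto simp: space_pair_measure abs_of_pos)

lemmas bmeas_K' = bmeas_compose2[OF bmeas_K]

lemma bmeas_kpow: "bmeas (M \<Otimes>\<^sub>M M) (\<lambda>(x, y). kpow M K j x y)"
proof (induction j)
  case 0
  show ?case using bmeas_K by simp
next
  case (Suc j)
  show ?case
    by (auto intro!: bmeas_pairI bmeas_integral bmeas_mult bmeas_K' bmeas_compose2[OF Suc])
qed

lemmas bmeas_kpow' = bmeas_compose2[OF bmeas_kpow]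

lemma kpow_bounds:
  assumes "x \<in> space M" "y \<in> space M"
  shows "d ^ Suc j \<le> kpow M K j x y \<and> kpow M K j x y \<le> 1"
  using assms(1)
proof (induction j arbitrary: x)
  case 0
  then show ?case using K_ge K_le assms by simp
next
  case (Suc j)
  have b: "bmeas M (\<lambda>z. K x z * kpow M K j z y)"
    using Suc assms by (auto intro!: bmeas_mult bmeas_K' bmeas_kpow')
  have "d * d ^ Suc j \<le> K x z * kpow M K j z y" if "z \<in> space M" for z
    using Suc that K_ge d_pos K_pos by (intro mult_mono) (auto intro: less_imp_le)
  moreover have "K x z * kpow M K j z y \<le> 1 * 1" if "z \<in> space M" for z
  proof -
    have "0 \<le> d ^ Suc j" using d_pos by simp
    then have "0 \<le> kpow M K j z y" using Suc.IH[OF that] by linarith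
    then show ?thesis using Suc that K_le by (intro mult_mono) auto
  qed
  ultimately show ?case
    using integral_ge_const[OF b, of "d ^ Suc (Suc j)"] integral_le_const[OF b, of 1] by simp
qed

lemma kpow_ge: "x \<in> space M \<Longrightarrow> y \<in> space M \<Longrightarrow> d ^ Suc j \<le> kpow M K j x y"
  using kpow_bounds by blast

lemma kpow_le: "x \<in> space M \<Longrightarrow> y \<in> space M \<Longrightarrow> kpow M K j x y \<le> 1"
  using kpow_bounds by blast

lemma kpow_pos: "x \<in> space M \<Longrightarrow> y \<in> space M \<Longrightarrow> 0 < kpow M K j x y"
  using kpow_ge d_pos by (meson less_le_trans zero_less_power)

lemma bmeas_ln_kpow: "bmeas (M \<Otimes>\<^sub>M M) (\<lambda>(x, y). ln (kpow M K j x y))"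
  using d_pos kpow_ge
  by (intro bmeas_pairI bmeas_ln[where d = "d ^ Suc j"] bmeas_kpow') (auto simp: space_pair_measure)

lemmas bmeas_ln_kpow' = bmeas_compose2[OF bmeas_ln_kpow]

lemma bmeas_ln_K: "bmeas (M \<Otimes>\<^sub>M M) (\<lambda>(x, y). ln (K x y))"
  using bmeas_ln_kpow[of 0] by simp

lemmas bmeas_ln_K' = bmeas_compose2[OF bmeas_ln_K]

text \<open>Since \<open>kpow M K i\<close> has \<open>i + 1\<close> steps, composing it with
  \<open>j + 1\<close> further steps gives index \<open>Suc (i + j)\<close>. The induction peels off
  the first step and exchanges the two integrals.\<close>

lemma kpow_comp:
  assumes "x \<in> space M" "y \<in> space M"
  shows "(\<integral>z. kpow M K i x z * kpow M K j z y \<partial>M) = kpow M K (Suc (i + j)) x y"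
  using assms(1)
proof (induction i arbitrary: x)
  case 0
  then show ?case by simp
next
  case (Suc i)
  have "(\<integral>z. kpow M K (Suc i) x z * kpow M K j z y \<partial>M)
      = (\<integral>z. \<integral>u. (K x u * kpow M K i u z) * kpow M K j z y \<partial>M \<partial>M)"
    by simp
  also have "\<dots> = (\<integral>u. \<integral>z. (K x u * kpow M K i u z) * kpow M K j z y \<partial>M \<partial>M)"
    using Suc assms
    by (intro integral_swap) (auto intro!: bmeas_pairI bmeas_mult bmeas_K' bmeas_kpow')
  also have "\<dots> = (\<integral>u. K x u * kpow M K (Suc (i + j)) u y \<partial>M)"
    using Suc by (intro Bochner_Integration.integral_cong) (simp_all add: mult.assoc del: kpow.simps)
  finally show ?case by simp
qed

lemma kpow_sym:
  assumes "x \<in> space M" "y \<in> space M"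
  shows "kpow M K j x y = kpow M K j y x"
  using assms
proof (induction j arbitrary: x y)
  case 0
  then show ?case by (simp add: K_sym)
next
  case (Suc j)
  \<comment> \<open>Read backwards, the first step out of \<open>x\<close> is a last step into
    \<open>x\<close>; \<open>kpow_comp\<close> then regroups the walk so that a first step is split
    off again.\<close>
  have "kpow M K (Suc j) x y = (\<integral>z. kpow M K j y z * kpow M K 0 z x \<partial>M)"
    using Suc K_sym by (auto intro!: Bochner_Integration.integral_cong simp: mult.commute)
  also have "\<dots> = kpow M K (Suc j) y x"
    using kpow_comp[of y x j 0] Suc by simp
  finally show ?case .
qed

text \<open>This lets the entropy estimate for walks be applied to a multi-step kernel in place of
  \<open>K\<close>.\<close>

lemma kernel_kpow: "kernel M (kpow M K j) (d ^ Suc j)"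
  using bmeas_kpow[of j] d_pos kpow_ge kpow_le kpow_sym
  by unfold_locales (auto simp: bmeas_def)

lemma bmeas_walk: "bmeas M (walk M K n)"
proof (induction n)
  case 0
  then show ?case by (simp add: bmeas_const)
next
  case (Suc n)
  show ?case
    by (auto intro!: bmeas_pairI bmeas_integral bmeas_mult bmeas_K' bmeas_compose[OF Suc])
qed

lemmas bmeas_walk' = bmeas_compose[OF bmeas_walk]

lemma walk_bounds:
  assumes "x \<in> space M"
  shows "d ^ n \<le> walk M K n x \<and> walk M K n x \<le> 1"
  using assms
proof (induction n arbitrary: x)
  case 0
  then show ?case by simp
next
  case (Suc n)
  have b: "bmeas M (\<lambda>z. K x z * walk M K n z)"
    using Suc by (auto intro!: bmeas_mult bmeas_K' bmeas_walk)
  have "d * d ^ n \<le> K x z * walk M K n z" if "z \<in> space M" for z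
    using Suc that K_ge d_pos K_pos by (intro mult_mono) (auto intro: less_imp_le)
  moreover have "K x z * walk M K n z \<le> 1 * 1" if "z \<in> space M" for z
  proof -
    have "0 \<le> d ^ n" using d_pos by simp
    then have "0 \<le> walk M K n z" using Suc.IH[OF that] by linarith
    then show ?thesis using Suc that K_le by (intro mult_mono) auto
  qed
  ultimately show ?case
    using integral_ge_const[OF b, of "d ^ Suc n"] integral_le_const[OF b, of 1] by simp
qed

lemma walk_pos: "x \<in> space M \<Longrightarrow> 0 < walk M K n x"
  using walk_bounds d_pos by (meson less_le_trans zero_less_power)

lemma bmeas_ln_walk: "bmeas M (\<lambda>x. ln (walk M K n x))"
  using d_pos walk_bounds by (intro bmeas_ln[where d = "d ^ n"] bmeas_walk) auto

lemmas bmeas_ln_walk' = bmeas_compose[OF bmeas_ln_walk]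

lemma integral_kpow_walk:
  assumes "x \<in> space M"
  shows "(\<integral>y. kpow M K j x y * walk M K n y \<partial>M) = walk M K (Suc j + n) x"
  using assms
proof (induction j arbitrary: x)
  case 0
  then show ?case by simp
next
  case (Suc j)
  have "(\<integral>y. kpow M K (Suc j) x y * walk M K n y \<partial>M)
      = (\<integral>y. \<integral>u. (K x u * kpow M K j u y) * walk M K n y \<partial>M \<partial>M)"
    by simp
  also have "\<dots> = (\<integral>u. \<integral>y. (K x u * kpow M K j u y) * walk M K n y \<partial>M \<partial>M)"
    using Suc
    by (intro integral_swap) (auto intro!: bmeas_pairI bmeas_mult bmeas_K' bmeas_kpow' bmeas_walk')
  also have "\<dots> = (\<integral>u. K x u * walk M K (Suc j + n) u \<partial>M)"
    using Suc by (intro Bochner_Integration.integral_cong) (simp_all add: mult.assoc del: kpow.simps walk.simps)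
  finally show ?case by simp
qed

lemma integral_kpow: "x \<in> space M \<Longrightarrow> (\<integral>y. kpow M K j x y \<partial>M) = walk M K (Suc j) x"
  using integral_kpow_walk[of x j 0] by simp

lemma walk_kpow: "x \<in> space M \<Longrightarrow> walk M (kpow M K j) n x = walk M K (Suc j * n) x"
proof (induction n arbitrary: x)
  case 0
  then show ?case by simp
next
  case (Suc n)
  have "walk M (kpow M K j) (Suc n) x = (\<integral>y. kpow M K j x y * walk M K (Suc j * n) y \<partial>M)"
    using Suc by (auto intro!: Bochner_Integration.integral_cong)
  then show ?case using integral_kpow_walk[OF Suc.prems] by simp
qed

end


section \<open>Entropy inequalities\<close>

text \<open>Three orders of integration are provided because the logarithmic terms in
  \<open>arc_ent_step\<close> depend on different pairs of the three vertices, and the remaining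
  vertex has to be integrated out first.\<close>

lemma integral_triple:
  assumes "prob_space M" "bmeas (M \<Otimes>\<^sub>M (M \<Otimes>\<^sub>M M)) f"
  shows "(\<integral>p. f p \<partial>(M \<Otimes>\<^sub>M (M \<Otimes>\<^sub>M M))) = (\<integral>x. \<integral>y. \<integral>z. f (x, y, z) \<partial>M \<partial>M \<partial>M)"
    and "(\<integral>p. f p \<partial>(M \<Otimes>\<^sub>M (M \<Otimes>\<^sub>M M))) = (\<integral>x. \<integral>z. \<integral>y. f (x, y, z) \<partial>M \<partial>M \<partial>M)"
    and "(\<integral>p. f p \<partial>(M \<Otimes>\<^sub>M (M \<Otimes>\<^sub>M M))) = (\<integral>y. \<integral>z. \<integral>x. f (x, y, z) \<partial>M \<partial>M \<partial>M)"
proof -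
  interpret prob_space M by fact
  have P2: "prob_space (M \<Otimes>\<^sub>M M)" by (rule prob_space_pair_self)
  have f: "bmeas (M \<Otimes>\<^sub>M (M \<Otimes>\<^sub>M M)) (\<lambda>(x, p). f (x, p))"
    using assms by simp
  have *: "(\<integral>p. f p \<partial>(M \<Otimes>\<^sub>M (M \<Otimes>\<^sub>M M))) = (\<integral>x. \<integral>p. f (x, p) \<partial>(M \<Otimes>\<^sub>M M) \<partial>M)"
    using integral_pair_fst[OF prob_space_axioms P2 f] by simp
  have sec: "bmeas (M \<Otimes>\<^sub>M M) (\<lambda>(y, z). f (x, y, z))" if "x \<in> space M" for x
    using that by (intro bmeas_pairI bmeas_compose[OF assms(2)]) simp
  show "(\<integral>p. f p \<partial>(M \<Otimes>\<^sub>M (M \<Otimes>\<^sub>M M))) = (\<integral>x. \<integral>y. \<integral>z. f (x, y, z) \<partial>M \<partial>M \<partial>M)"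
    unfolding * using integral_pair_fst[OF prob_space_axioms prob_space_axioms sec]
    by (intro Bochner_Integration.integral_cong) (simp_all add: case_prod_beta')
  show "(\<integral>p. f p \<partial>(M \<Otimes>\<^sub>M (M \<Otimes>\<^sub>M M))) = (\<integral>x. \<integral>z. \<integral>y. f (x, y, z) \<partial>M \<partial>M \<partial>M)"
    unfolding * using integral_pair_snd[OF prob_space_axioms prob_space_axioms sec]
    by (intro Bochner_Integration.integral_cong) (simp_all add: case_prod_beta')
  have g: "bmeas (M \<Otimes>\<^sub>M M) (\<lambda>(y, z). \<integral>x. f (x, y, z) \<partial>M)"
    by (intro bmeas_pairI bmeas_integral bmeas_compose[OF assms(2)]) simp
  have "(\<integral>p. f p \<partial>(M \<Otimes>\<^sub>M (M \<Otimes>\<^sub>M M))) = (\<integral>p. \<integral>x. f (x, p) \<partial>M \<partial>(M \<Otimes>\<^sub>M M))"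
    using integral_pair_snd[OF prob_space_axioms P2 f] by simp
  also have "\<dots> = (\<integral>y. \<integral>z. \<integral>x. f (x, y, z) \<partial>M \<partial>M \<partial>M)"
    using integral_pair_fst[OF prob_space_axioms prob_space_axioms g]
    by (simp add: case_prod_beta')
  finally show "(\<integral>p. f p \<partial>(M \<Otimes>\<^sub>M (M \<Otimes>\<^sub>M M))) = (\<integral>y. \<integral>z. \<integral>x. f (x, y, z) \<partial>M \<partial>M \<partial>M)" .
qed

section \<open>Linear combinations of the entropy inequalities\<close>

text \<open>In the application \<open>k = m - 1\<close>, \<open>c\<close> is the cycle density,
  \<open>L = ln c\<close>, and \<open>a\<close> is the logarithm of the path density. The claim is
  \<open>k\<close> times \<open>path\<close> plus \<open>n\<close> times \<open>chain\<close> plus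
  \<open>n - k\<close> times \<open>ent\<close>, divided by \<open>c * k\<close>;
  \<open>k \<le> n\<close> makes the last weight nonnegative.\<close>

lemma long_path_arith:
  fixes k n c L F B a :: real
  assumes k: "0 < k" "k \<le> n" and c: "0 < c"
    and path: "c * L - n * F + (n - 1) * B \<le> c * a"
    and chain: "k * F - (k - 1) * B \<le> 0" and ent: "c * L \<le> B"
  shows "n / k * L \<le> a"
proof -
  have "n * (c * L) + (n - k) * (c * L) \<le> n * (c * L) + (n - k) * B"
    using k ent by (intro add_left_mono mult_left_mono) auto
  then have "n * (c * L) \<le> k * (c * L) + (n - k) * B"
    by (simp add: algebra_simps)
  moreover have "n * (k * F - (k - 1) * B) \<le> n * 0"
    using k chain by (intro mult_left_mono) auto
  moreover have "k * (c * L - n * F + (n - 1) * B) \<le> k * (c * a)"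
    using k path by (intro mult_left_mono) auto
  moreover have "k * (c * L - n * F + (n - 1) * B)
      = k * (c * L) + (n - k) * B - n * (k * F - (k - 1) * B)"
    by (simp add: algebra_simps)
  ultimately have "n * (c * L) \<le> k * (c * a)" by linarith
  then have "c * (n * L) \<le> c * (k * a)" by (simp add: mult_ac)
  then show ?thesis using c k by (simp add: field_simps)
qed

text \<open>Interpolation between path lengths 0 and \<open>k\<close>, with weights
  \<open>k - n\<close> and \<open>n\<close>. The variables are as in \<open>long_path_arith\<close>,
  and \<open>E\<close> is the mean logarithmic weight of one edge of the cycle.\<close>

lemma short_path_arith:
  fixes k n c L F B a E :: real
  assumes k: "0 < k" "n \<le> k" "0 \<le> n" and c: "0 < c" and E: "E \<le> 0"
    and path: "c * L - n * F + (n - 1) * B \<le> c * a"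
    and chain: "k * F - (k - 1) * B \<le> E"
    and vertex: "2 * B - E - F \<le> c * L"
  shows "(n + 1) / (k + 1) * L \<le> a"
proof -
  have "k * (2 * B - E - F) \<le> k * (c * L)"
    using k vertex by (intro mult_left_mono) auto
  moreover have "k * E \<le> k * 0"
    using k E by (intro mult_left_mono) auto
  moreover have "k * (2 * B - E - F) = (k + 1) * B - k * E - (k * F - (k - 1) * B)"
    by (simp add: algebra_simps)
  \<comment> \<open>This is the bound at length 0: with \<open>L = ln c\<close> it says that the
    entropy \<open>L - B / c\<close> of one vertex is at least \<open>L / (k + 1)\<close>.\<close>
  ultimately have "(k + 1) * B \<le> k * (c * L)" using chain E by linarith
  then have B: "(k - n) * ((k + 1) * B) \<le> (k - n) * (k * (c * L))"
    using k by (intro mult_left_mono) auto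
  have Z: "((k + 1) * n) * (k * F - (k - 1) * B) \<le> 0"
    using k chain E by (intro mult_nonneg_nonpos) auto
  have P: "((k + 1) * k) * (c * L - n * F + (n - 1) * B) \<le> ((k + 1) * k) * (c * a)"
    using k path by (intro mult_left_mono) auto
  have eq: "((k + 1) * k) * (c * L - n * F + (n - 1) * B)
      = (n + 1) * k * (c * L) + ((k - n) * (k * (c * L)) - (k - n) * ((k + 1) * B))
        - ((k + 1) * n) * (k * F - (k - 1) * B)"
    by (simp add: algebra_simps)
  \<comment> \<open>The nonlinear products are abstracted to variables, so that only a linear
    inequality is left to check.\<close>
  have "r \<le> q" if "x \<le> y" "z \<le> 0" "p \<le> q" "p = r + (y - x) - z" for p q r x y z :: real
    using that by linarith
  from this[OF B Z P eq] have "(n + 1) * k * (c * L) \<le> ((k + 1) * k) * (c * a)" .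
  then have "(k * c) * ((n + 1) * L) \<le> (k * c) * ((k + 1) * a)" by (simp add: mult_ac)
  then have "(n + 1) * L \<le> (k + 1) * a"
    using c k by (elim mult_left_le_imp_le) auto
  then show ?thesis using k by (simp add: pos_divide_le_eq mult.commute)
qed

context kernel
begin

text \<open>Jensen's inequality applied step by step to the Markov chain with edge distribution \<open>N\<close>
  (up to normalisation) bounds the number of walks by the entropy of the chain.\<close>

lemma walk_entropy:
  fixes N :: "'a \<Rightarrow> 'a \<Rightarrow> real"
  assumes "kernel M N e"
  defines "\<nu> \<equiv> walk M N 1"
  defines "c \<equiv> \<integral>x. \<nu> x \<partial>M"
  defines "A \<equiv> \<integral>x. \<integral>y. N x y * (ln (K x y) - ln (N x y)) \<partial>M \<partial>M"
  defines "B \<equiv> \<integral>x. \<nu> x * ln (\<nu> x) \<partial>M"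
  shows "c * ln c + real n * A + (real n - 1) * B \<le> c * ln (\<integral>x. walk M K n x \<partial>M)"
proof -
  interpret N: kernel M N e by fact
  have \<nu>: "bmeas M \<nu>" unfolding \<nu>_def by (rule N.bmeas_walk)
  have \<nu>_ge: "e \<le> \<nu> x" if "x \<in> space M" for x
    using N.walk_bounds[OF that, of 1] by (simp add: \<nu>_def)
  have \<nu>_pos: "0 < \<nu> x" if "x \<in> space M" for x
    using \<nu>_ge[OF that] N.d_pos by linarith
  have ln_\<nu>: "bmeas M (\<lambda>x. ln (\<nu> x))"
    unfolding \<nu>_def by (rule N.bmeas_ln_walk)
  have lnN: "bmeas (M \<Otimes>\<^sub>M M) (\<lambda>(x, y). ln (N x y))" and lnK: "bmeas (M \<Otimes>\<^sub>M M) (\<lambda>(x, y). ln (K x y))"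
    using N.bmeas_ln_kpow[of 0] bmeas_ln_kpow[of 0] by simp_all
  note lnN' = bmeas_compose2[OF lnN] and lnK' = bmeas_compose2[OF lnK]
  have "e \<le> c" unfolding c_def by (rule integral_ge_const[OF \<nu> \<nu>_ge])
  then have c: "c > 0" using N.d_pos by linarith
  \<comment> \<open>Starting from a vertex with unnormalised law \<open>\<nu>\<close>,
    \<open>L n\<close> is the mean logarithm of the number of \<open>n\<close>-step walks. Each
    further step of the chain raises it by at least \<open>A + B\<close>.\<close>
  define L where "L n = (\<integral>x. \<nu> x * ln (walk M K n x) \<partial>M)" for n
  have step: "A + L n + B \<le> L (Suc n)" for n
  proof -
    let ?I = "\<lambda>x. (\<integral>y. N x y * (ln (K x y) - ln (N x y)) \<partial>M) + (\<integral>y. N x y * ln (walk M K n y) \<partial>M)"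
    have "?I x \<le> \<nu> x * ln (walk M K (Suc n) x) - \<nu> x * ln (\<nu> x)" if x: "x \<in> space M" for x
    proof -
      \<comment> \<open>The weight of a step to \<open>y\<close> and of the \<open>n\<close> steps
        after it, relative to the step law \<open>N x\<close>. Its \<open>N x\<close>-integral is
        the number of walks with one more step, so Jensen's inequality over \<open>y\<close>
        applies.\<close>
      define u where "u y = K x y * walk M K n y / N x y" for y
      have u: "bmeas M u"
        unfolding u_def using x N.K_ge N.d_pos
        by (intro bmeas_divide[where d = e] bmeas_mult bmeas_K' bmeas_walk N.bmeas_K') auto
      have u_ge: "d * d ^ n \<le> u y" if "y \<in> space M" for y
      proof -
        have "d * d ^ n \<le> K x y * walk M K n y"
          using that x K_ge walk_bounds[of y n] d_pos K_pos
          by (intro mult_mono) (auto intro: less_imp_le)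
        also have "\<dots> \<le> u y"
          using that x K_pos[of x y] walk_pos[of y n] N.K_pos[of x y] N.K_le[of x y]
          by (auto simp: u_def field_simps)
        finally show ?thesis .
      qed
      have "?I x = (\<integral>y. N x y * (ln (K x y) - ln (N x y)) + N x y * ln (walk M K n y) \<partial>M)"
        using x
        by (subst Bochner_Integration.integral_add)
          (auto intro!: bmeas_integrable bmeas_mult bmeas_diff N.bmeas_K' lnN' lnK' bmeas_ln_walk)
      also have "\<dots> = (\<integral>y. N x y * ln (u y) \<partial>M)"
      proof (intro Bochner_Integration.integral_cong refl)
        fix y assume y: "y \<in> space M"
        show "N x y * (ln (K x y) - ln (N x y)) + N x y * ln (walk M K n y) = N x y * ln (u y)"
          using K_pos[OF x y] N.K_pos[OF x y] walk_pos[OF y, of n]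
          by (simp add: u_def ln_div ln_mult algebra_simps)
      qed
      also have "\<dots> \<le> \<nu> x * ln (walk M K (Suc n) x / \<nu> x)"
      proof (rule jensen_ln[OF _ u _ _ u_ge])
        show "bmeas M (N x)" using x by (intro N.bmeas_K') auto
        show "\<And>y. y \<in> space M \<Longrightarrow> 0 \<le> N x y" using N.K_pos x by (auto intro: less_imp_le)
        show "(\<integral>y. N x y \<partial>M) = \<nu> x" by (simp add: \<nu>_def)
        have "N x y * u y = K x y * walk M K n y" if "y \<in> space M" for y
          using N.K_pos[OF x that] by (simp add: u_def)
        then show "(\<integral>y. N x y * u y \<partial>M) = walk M K (Suc n) x"
          by (auto intro!: Bochner_Integration.integral_cong)
      qed (use d_pos \<nu>_pos x in auto)
      also have "\<dots> = \<nu> x * ln (walk M K (Suc n) x) - \<nu> x * ln (\<nu> x)"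
        using \<nu>_pos[OF x] walk_pos[OF x, of "Suc n"]
        by (simp add: ln_div right_diff_distrib del: walk.simps)
      finally show ?thesis .
    qed
    then have "(\<integral>x. ?I x \<partial>M) \<le> (\<integral>x. \<nu> x * ln (walk M K (Suc n) x) - \<nu> x * ln (\<nu> x) \<partial>M)"
      by (intro integral_mono bmeas_integrable)
        (auto simp del: walk.simps intro!: bmeas_add bmeas_diff bmeas_mult bmeas_integral bmeas_pairI N.bmeas_K' lnN' lnK'
          bmeas_ln_walk' \<nu> ln_\<nu>)
    also have "\<dots> = L (Suc n) - B"
      unfolding L_def B_def
      by (intro Bochner_Integration.integral_diff bmeas_integrable bmeas_mult \<nu> ln_\<nu> bmeas_ln_walk)
    also have "(\<integral>x. ?I x \<partial>M) = A + (\<integral>x. \<integral>y. N x y * ln (walk M K n y) \<partial>M \<partial>M)"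
      unfolding A_def
      by (intro Bochner_Integration.integral_add bmeas_integrable)
        (auto intro!: bmeas_diff bmeas_mult bmeas_integral bmeas_pairI N.bmeas_K' lnN' lnK' bmeas_ln_walk')
    \<comment> \<open>Symmetry of \<open>N\<close> makes \<open>\<nu>\<close> the marginal in
      \<open>y\<close> as well: the chain is stationary, and averaging over \<open>y\<close> gives
      \<open>L n\<close> again.\<close>
    also have "(\<integral>x. \<integral>y. N x y * ln (walk M K n y) \<partial>M \<partial>M)
        = (\<integral>y. \<integral>x. N x y * ln (walk M K n y) \<partial>M \<partial>M)"
      by (intro integral_swap) (auto intro!: bmeas_mult bmeas_pairI N.bmeas_K' bmeas_ln_walk')
    also have "\<dots> = L n"
      unfolding L_def
    proof (intro Bochner_Integration.integral_cong refl)
      fix y assume y: "y \<in> space M"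
      have "(\<integral>x. N x y \<partial>M) = \<nu> y"
        using y N.K_sym by (auto simp: \<nu>_def intro!: Bochner_Integration.integral_cong)
      then show "(\<integral>x. N x y * ln (walk M K n y) \<partial>M) = \<nu> y * ln (walk M K n y)"
        by simp
    qed
    finally show ?thesis by linarith
  qed
  have "real n * (A + B) \<le> L n" for n
  proof (induction n)
    case 0
    then show ?case by (simp add: L_def)
  next
    case (Suc n)
    then show ?case using step[of n] by (simp add: algebra_simps del: walk.simps)
  qed
  \<comment> \<open>A last use of Jensen's inequality averages over the starting vertex; subtracting
    \<open>B\<close> accounts for the entropy of that vertex.\<close>
  moreover have "L n - B \<le> c * ln ((\<integral>x. walk M K n x \<partial>M) / c)"
  proof -
    have "L n - B = (\<integral>x. \<nu> x * ln (walk M K n x) - \<nu> x * ln (\<nu> x) \<partial>M)"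
      unfolding L_def B_def
      by (intro Bochner_Integration.integral_diff[symmetric] bmeas_integrable bmeas_mult \<nu> ln_\<nu> bmeas_ln_walk)
    also have "\<dots> = (\<integral>x. \<nu> x * ln (walk M K n x / \<nu> x) \<partial>M)"
    proof (intro Bochner_Integration.integral_cong refl)
      show "\<nu> x * ln (walk M K n x) - \<nu> x * ln (\<nu> x) = \<nu> x * ln (walk M K n x / \<nu> x)"
        if x: "x \<in> space M" for x
        using \<nu>_pos[OF x] walk_pos[OF x, of n] by (simp add: ln_div right_diff_distrib)
    qed
    also have "\<dots> \<le> c * ln ((\<integral>x. walk M K n x \<partial>M) / c)"
    proof (rule jensen_ln[where d = "d ^ n"])
      show "bmeas M (\<lambda>x. walk M K n x / \<nu> x)"
        using \<nu>_ge N.d_pos by (intro bmeas_divide[where d = e] bmeas_walk \<nu>) auto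
      show "d ^ n \<le> walk M K n x / \<nu> x" if x: "x \<in> space M" for x
      proof -
        have "\<nu> x \<le> 1" using N.walk_bounds[OF x, of 1] by (simp add: \<nu>_def)
        then have "walk M K n x \<le> walk M K n x / \<nu> x"
          using \<nu>_pos[OF x] walk_pos[OF x, of n] by (simp add: field_simps)
        then show ?thesis using walk_bounds[OF x, of n] by linarith
      qed
      show "(\<integral>x. \<nu> x * (walk M K n x / \<nu> x) \<partial>M) = (\<integral>x. walk M K n x \<partial>M)"
      proof (intro Bochner_Integration.integral_cong refl)
        show "\<nu> x * (walk M K n x / \<nu> x) = walk M K n x" if "x \<in> space M" for x
          using \<nu>_pos[OF that] by simp
      qed
    qed (use \<nu> \<nu>_pos c d_pos in \<open>auto simp: c_def intro: less_imp_le\<close>)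
    finally show ?thesis .
  qed
  moreover have "c * ln ((\<integral>x. walk M K n x \<partial>M) / c) = c * ln (\<integral>x. walk M K n x \<partial>M) - c * ln c"
  proof -
    have "d ^ n \<le> (\<integral>x. walk M K n x \<partial>M)"
      using walk_bounds by (intro integral_ge_const bmeas_walk) auto
    then have "0 < (\<integral>x. walk M K n x \<partial>M)" using d_pos by (meson less_le_trans zero_less_power)
    then show ?thesis using c by (simp add: ln_div right_diff_distrib)
  qed
  ultimately have "real n * (A + B) - B \<le> c * ln (\<integral>x. walk M K n x \<partial>M) - c * ln c"
    by (smt (verit))
  then show ?thesis by (simp add: algebra_simps)
qed


section \<open>Entropy of a random closed walk\<close>

text \<open>\<open>kpow M K (Suc q)\<close> has \<open>q + 2\<close> steps, so this is the weight of
  closed walks of length \<open>q + 2\<close> based at \<open>x\<close>.\<close>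

definition cyc :: "nat \<Rightarrow> 'a \<Rightarrow> real" where
  "cyc q x = kpow M K (Suc q) x x"

lemma bmeas_cyc: "bmeas M (cyc q)"
  unfolding cyc_def by (intro bmeas_kpow') auto

lemmas bmeas_cyc' = bmeas_compose[OF bmeas_cyc]

lemma cyc_ge: "x \<in> space M \<Longrightarrow> d ^ Suc (Suc q) \<le> cyc q x"
  unfolding cyc_def by (rule kpow_ge)

lemma cyc_pos: "x \<in> space M \<Longrightarrow> 0 < cyc q x"
  unfolding cyc_def by (rule kpow_pos)

lemma cyc_le: "x \<in> space M \<Longrightarrow> cyc q x \<le> 1"
  unfolding cyc_def by (rule kpow_le)

lemma bmeas_ln_cyc: "bmeas M (\<lambda>x. ln (cyc q x))"
  unfolding cyc_def by (intro bmeas_ln_kpow') auto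

lemmas bmeas_ln_cyc' = bmeas_compose[OF bmeas_ln_cyc]

text \<open>Cutting a closed walk at \<open>x\<close> and \<open>y\<close> leaves arcs of
  \<open>i + 1\<close> and \<open>j + 1\<close> steps; by symmetry both can be read from
  \<open>x\<close> to \<open>y\<close>.\<close>

lemma cyc_eq:
  assumes "x \<in> space M" "i + j = q"
  shows "(\<integral>y. kpow M K i x y * kpow M K j x y \<partial>M) = cyc q x"
proof -
  have "(\<integral>y. kpow M K i x y * kpow M K j x y \<partial>M) = (\<integral>y. kpow M K i x y * kpow M K j y x \<partial>M)"
    using assms(1) kpow_sym by (intro Bochner_Integration.integral_cong) auto
  then show ?thesis
    using kpow_comp[of x x i j] assms by (simp add: cyc_def del: kpow.simps)
qed

text \<open>With respect to the unnormalised distribution of a random closed \<open>(q + 2)\<close>-walk, this is the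
  expected logarithm of the number of ways to fill in an arc of \<open>i + 1\<close> edges between its end points.\<close>

definition arc_ent :: "nat \<Rightarrow> nat \<Rightarrow> real" where
  "arc_ent q i = (\<integral>x. \<integral>y. kpow M K (q - i) x y * kpow M K i x y * ln (kpow M K i x y) \<partial>M \<partial>M)"

text \<open>With \<open>c\<close> the integral of \<open>cyc q\<close>, the entropy of one vertex of
  the random closed walk is \<open>ln c - cyc_ent q / c\<close>.\<close>

definition cyc_ent :: "nat \<Rightarrow> real" where
  "cyc_ent q = (\<integral>x. cyc q x * ln (cyc q x) \<partial>M)"

text \<open>Gibbs' inequality for the three vertices \<open>x, y, z\<close>, where \<open>x, y\<close> are adjacent on the cycle
  and \<open>z\<close> is reached from \<open>y\<close> by \<open>i + 1\<close> further edges: conditioning the next vertex \<open>y\<close> on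
  \<open>z\<close> in addition to \<open>x\<close> does not increase its entropy.\<close>

lemma arc_ent_step:
  assumes "i < q"
  shows "arc_ent q q - cyc_ent q + arc_ent q (Suc i) - arc_ent q i \<le> 0"
proof -
  define j where "j = q - Suc i"
  have ij: "Suc (i + j) = q" "q - i = Suc j" "q - Suc i = j" using assms by (auto simp: j_def)
  let ?R = "kpow M K"
  let ?P = "M \<Otimes>\<^sub>M (M \<Otimes>\<^sub>M M)"
  \<comment> \<open>The weight of closed walks through \<open>x\<close>, \<open>y\<close>,
    \<open>z\<close>, with arcs of 1, \<open>i + 1\<close> and \<open>j + 1\<close> edges.\<close>
  define T where "T p = (case p of (x, y, z) \<Rightarrow> ?R j z x * K x y * ?R i y z)" for p
  \<comment> \<open>The conditional density of \<open>y\<close> given \<open>x\<close>, divided by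
    its conditional density given \<open>x\<close> and \<open>z\<close>; the factor
    \<open>K x y\<close> cancels. As \<open>T\<close> and \<open>T * U\<close> have the same mass,
    Jensen's inequality gives a bound of 0.\<close>
  define U where "U p = (case p of (x, y, z) \<Rightarrow> ?R q x y * ?R (Suc i) x z / (cyc q x * ?R i y z))" for p
  define c where "c = (\<integral>x. cyc q x \<partial>M)"
  define D where "D = d ^ Suc (Suc q) * d ^ Suc i"
  interpret P: prob_space ?P
    by (intro prob_space_pair prob_space_axioms)
  have D0: "D > 0" using d_pos by (simp add: D_def)
  have D_le: "D \<le> cyc q x * ?R i y z" if "x \<in> space M" "y \<in> space M" "z \<in> space M" for x y z
    unfolding D_def using that cyc_ge kpow_ge d_pos cyc_pos kpow_pos
    by (intro mult_mono) (auto intro: less_imp_le simp del: kpow.simps power_Suc)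
  have bT: "bmeas ?P T"
    unfolding T_def case_prod_beta' by (auto intro!: bmeas_mult bmeas_K' bmeas_kpow')
  have bU: "bmeas ?P U"
    unfolding U_def case_prod_beta' using D_le D0
    by (intro bmeas_divide[where d = D] bmeas_mult bmeas_kpow' bmeas_cyc')
      (auto simp: space_pair_measure)
  have U_ge: "d ^ Suc q * d ^ Suc (Suc i) \<le> U p" if "p \<in> space ?P" for p
  proof -
    from that obtain x y z where p: "p = (x, y, z)" "x \<in> space M" "y \<in> space M" "z \<in> space M"
      by (auto simp: space_pair_measure)
    have "d ^ Suc q * d ^ Suc (Suc i) \<le> ?R q x y * ?R (Suc i) x z"
      using p kpow_ge d_pos kpow_pos
      by (intro mult_mono) (auto intro: less_imp_le simp del: kpow.simps power_Suc)
    also have "\<dots> \<le> U p"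
    proof -
      have "cyc q x * ?R i y z \<le> 1 * 1"
        using p cyc_le kpow_le kpow_pos by (intro mult_mono) (auto intro: less_imp_le)
      then show ?thesis
        using p cyc_pos[of x q] kpow_pos[of y z i] kpow_pos[of x y q] kpow_pos[of x z "Suc i"]
        by (simp add: U_def le_divide_eq mult_left_le del: kpow.simps)
    qed
    finally show ?thesis .
  qed
  have T_int: "(\<integral>p. T p \<partial>?P) = c"
  proof -
    have "(\<integral>p. T p \<partial>?P) = (\<integral>x. \<integral>y. \<integral>z. T (x, y, z) \<partial>M \<partial>M \<partial>M)"
      by (rule integral_triple[OF prob_space_axioms bT])
    also have "\<dots> = (\<integral>x. \<integral>y. K x y * ?R q x y \<partial>M \<partial>M)"
    proof (intro Bochner_Integration.integral_cong refl)
      fix x y assume "x \<in> space M" "y \<in> space M"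
      then have "?R q x y = (\<integral>z. ?R i y z * ?R j z x \<partial>M)"
        using kpow_comp[of y x i j] kpow_sym[of x y q] ij(1) by simp
      then show "(\<integral>z. T (x, y, z) \<partial>M) = K x y * ?R q x y"
        by (simp add: T_def mult_ac)
    qed
    also have "\<dots> = c"
      unfolding c_def using cyc_eq[of _ 0 q q] by (intro Bochner_Integration.integral_cong) auto
    finally show ?thesis .
  qed
  have c0: "c > 0"
    using integral_ge_const[OF bmeas_cyc cyc_ge, of q] d_pos
    by (auto simp: c_def simp del: power_Suc intro: less_le_trans[OF zero_less_power])
  have TU_int: "(\<integral>p. T p * U p \<partial>?P) = c"
  proof -
    have "(\<integral>p. T p * U p \<partial>?P) = (\<integral>x. \<integral>z. \<integral>y. T (x, y, z) * U (x, y, z) \<partial>M \<partial>M \<partial>M)"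
      by (rule integral_triple[OF prob_space_axioms bmeas_mult[OF bT bU]])
    \<comment> \<open>Integrating out \<open>y\<close> first turns \<open>K x y * ?R q x y\<close>
      into \<open>cyc q x\<close>, which cancels the denominator and leaves the two arcs between
      \<open>x\<close> and \<open>z\<close>.\<close>
    also have "\<dots> = (\<integral>x. \<integral>z. ?R j x z * ?R (Suc i) x z \<partial>M \<partial>M)"
    proof (intro Bochner_Integration.integral_cong refl)
      fix x z assume xz: "x \<in> space M" "z \<in> space M"
      have "(\<integral>y. T (x, y, z) * U (x, y, z) \<partial>M)
          = (\<integral>y. (?R j x z * ?R (Suc i) x z / cyc q x) * (?R 0 x y * ?R q x y) \<partial>M)"
      proof (intro Bochner_Integration.integral_cong refl)
        fix y assume y: "y \<in> space M"
        show "T (x, y, z) * U (x, y, z) = (?R j x z * ?R (Suc i) x z / cyc q x) * (?R 0 x y * ?R q x y)"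
          using kpow_pos[OF y xz(2), of i] kpow_sym[OF xz, of j]
          by (simp add: T_def U_def field_simps del: kpow.simps(2))
      qed
      also have "\<dots> = (?R j x z * ?R (Suc i) x z / cyc q x) * cyc q x"
        unfolding integral_mult_right_zero using cyc_eq[OF xz(1), of 0 q q] by simp
      finally show "(\<integral>y. T (x, y, z) * U (x, y, z) \<partial>M) = ?R j x z * ?R (Suc i) x z"
        using cyc_pos[OF xz(1), of q] by simp
    qed
    also have "\<dots> = c"
      unfolding c_def using cyc_eq[of _ j "Suc i" q] ij(1)
      by (intro Bochner_Integration.integral_cong) auto
    finally show ?thesis .
  qed
  define t1 where "t1 p = (case p of (x, y, z) \<Rightarrow> T p * ln (?R q x y))" for p
  define t2 where "t2 p = (case p of (x, y, z) \<Rightarrow> T p * ln (?R (Suc i) x z))" for p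
  define t3 where "t3 p = (case p of (x, y, z) \<Rightarrow> T p * ln (cyc q x))" for p
  define t4 where "t4 p = (case p of (x, y, z) \<Rightarrow> T p * ln (?R i y z))" for p
  have b: "bmeas ?P t1" "bmeas ?P t2" "bmeas ?P t3" "bmeas ?P t4"
    unfolding t1_def t2_def t3_def t4_def case_prod_beta'
    by (auto intro!: bmeas_mult bT bmeas_ln_kpow' bmeas_ln_cyc' simp del: kpow.simps)
  \<comment> \<open>Each of the four logarithms involves at most two vertices; integrating out the
    others merges arcs of the cycle and leaves the weight that appears in \<open>arc_ent\<close> or
    \<open>cyc_ent\<close>.\<close>
  have i1: "(\<integral>p. t1 p \<partial>?P) = arc_ent q q"
  proof -
    have "(\<integral>p. t1 p \<partial>?P) = (\<integral>x. \<integral>y. \<integral>z. t1 (x, y, z) \<partial>M \<partial>M \<partial>M)"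
      by (rule integral_triple[OF prob_space_axioms b(1)])
    also have "\<dots> = (\<integral>x. \<integral>y. K x y * ?R q x y * ln (?R q x y) \<partial>M \<partial>M)"
    proof (intro Bochner_Integration.integral_cong refl)
      fix x y assume "x \<in> space M" "y \<in> space M"
      then have "?R q x y = (\<integral>z. ?R i y z * ?R j z x \<partial>M)"
        using kpow_comp[of y x i j] kpow_sym[of x y q] ij(1) by simp
      moreover have "(\<integral>z. t1 (x, y, z) \<partial>M) = (\<integral>z. (K x y * ln (?R q x y)) * (?R i y z * ?R j z x) \<partial>M)"
        by (simp add: t1_def T_def mult_ac)
      ultimately show "(\<integral>z. t1 (x, y, z) \<partial>M) = K x y * ?R q x y * ln (?R q x y)"
        unfolding integral_mult_right_zero by (metis mult.assoc mult.commute)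
    qed
    finally show ?thesis by (simp add: arc_ent_def)
  qed
  have i2: "(\<integral>p. t2 p \<partial>?P) = arc_ent q (Suc i)"
  proof -
    have "(\<integral>p. t2 p \<partial>?P) = (\<integral>x. \<integral>z. \<integral>y. t2 (x, y, z) \<partial>M \<partial>M \<partial>M)"
      by (rule integral_triple[OF prob_space_axioms b(2)])
    also have "\<dots> = (\<integral>x. \<integral>z. ?R j x z * ?R (Suc i) x z * ln (?R (Suc i) x z) \<partial>M \<partial>M)"
    proof (intro Bochner_Integration.integral_cong refl)
      fix x z assume xz: "x \<in> space M" "z \<in> space M"
      have "(\<integral>y. t2 (x, y, z) \<partial>M) = (\<integral>y. (?R j x z * ln (?R (Suc i) x z)) * (K x y * ?R i y z) \<partial>M)"
        by (simp add: t2_def T_def kpow_sym[OF xz, of j] mult_ac del: kpow.simps)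
      also have "\<dots> = ?R j x z * ln (?R (Suc i) x z) * ?R (Suc i) x z"
        by (subst integral_mult_right_zero) simp
      finally show "(\<integral>y. t2 (x, y, z) \<partial>M) = ?R j x z * ?R (Suc i) x z * ln (?R (Suc i) x z)"
        by (simp add: mult_ac)
    qed
    finally show ?thesis by (simp only: arc_ent_def ij)
  qed
  have i3: "(\<integral>p. t3 p \<partial>?P) = cyc_ent q"
  proof -
    have "(\<integral>p. t3 p \<partial>?P) = (\<integral>x. \<integral>y. \<integral>z. t3 (x, y, z) \<partial>M \<partial>M \<partial>M)"
      by (rule integral_triple[OF prob_space_axioms b(3)])
    also have "\<dots> = (\<integral>x. \<integral>y. ln (cyc q x) * (?R 0 x y * ?R q x y) \<partial>M \<partial>M)"
    proof (intro Bochner_Integration.integral_cong refl)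
      fix x y assume "x \<in> space M" "y \<in> space M"
      then have "?R q x y = (\<integral>z. ?R i y z * ?R j z x \<partial>M)"
        using kpow_comp[of y x i j] kpow_sym[of x y q] ij(1) by simp
      moreover have "(\<integral>z. t3 (x, y, z) \<partial>M) = (\<integral>z. (K x y * ln (cyc q x)) * (?R i y z * ?R j z x) \<partial>M)"
        by (simp add: t3_def T_def mult_ac)
      ultimately show "(\<integral>z. t3 (x, y, z) \<partial>M) = ln (cyc q x) * (?R 0 x y * ?R q x y)"
        unfolding integral_mult_right_zero by (simp add: mult_ac del: kpow.simps(2))
    qed
    also have "\<dots> = cyc_ent q"
      unfolding cyc_ent_def
    proof (intro Bochner_Integration.integral_cong refl)
      fix x assume x: "x \<in> space M"
      show "(\<integral>y. ln (cyc q x) * (?R 0 x y * ?R q x y) \<partial>M) = cyc q x * ln (cyc q x)"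
        unfolding integral_mult_right_zero using cyc_eq[OF x, of 0 q q] by simp
    qed
    finally show ?thesis .
  qed
  \<comment> \<open>Here \<open>x\<close> is integrated out, so the base point moves to
    \<open>y\<close>: the arc from \<open>z\<close> back to \<open>y\<close> through
    \<open>x\<close> has kernel index \<open>Suc j = q - i\<close>.\<close>
  have i4: "(\<integral>p. t4 p \<partial>?P) = arc_ent q i"
  proof -
    have "(\<integral>p. t4 p \<partial>?P) = (\<integral>y. \<integral>z. \<integral>x. t4 (x, y, z) \<partial>M \<partial>M \<partial>M)"
      by (rule integral_triple[OF prob_space_axioms b(4)])
    also have "\<dots> = (\<integral>y. \<integral>z. ?R (Suc j) y z * ?R i y z * ln (?R i y z) \<partial>M \<partial>M)"
    proof (intro Bochner_Integration.integral_cong refl)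
      fix y z assume yz: "y \<in> space M" "z \<in> space M"
      have "(\<integral>x. t4 (x, y, z) \<partial>M) = (\<integral>x. (?R i y z * ln (?R i y z)) * (?R j z x * ?R 0 x y) \<partial>M)"
        by (simp add: t4_def T_def mult_ac)
      also have "\<dots> = ?R i y z * ln (?R i y z) * ?R (Suc j) z y"
        unfolding integral_mult_right_zero using kpow_comp[OF yz(2,1), of j 0] by simp
      finally show "(\<integral>x. t4 (x, y, z) \<partial>M) = ?R (Suc j) y z * ?R i y z * ln (?R i y z)"
        using kpow_sym[OF yz, of "Suc j"] by (simp add: mult_ac)
    qed
    finally show ?thesis by (simp only: arc_ent_def ij)
  qed
  have "(\<integral>p. T p * ln (U p) \<partial>?P) \<le> c * ln (c / c)"
  proof (rule P.jensen_ln[OF bT bU _ _ U_ge T_int c0 TU_int])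
    show "0 \<le> T p" if "p \<in> space ?P" for p
      using that kpow_pos K_pos
      by (auto simp: T_def space_pair_measure intro!: mult_nonneg_nonneg intro: less_imp_le)
  qed (use d_pos in simp)
  then have "(\<integral>p. T p * ln (U p) \<partial>?P) \<le> 0" using c0 by simp
  also have "(\<integral>p. T p * ln (U p) \<partial>?P) = (\<integral>p. t1 p + t2 p - t3 p - t4 p \<partial>?P)"
  proof (intro Bochner_Integration.integral_cong refl)
    fix p assume "p \<in> space ?P"
    then obtain x y z where p: "p = (x, y, z)" "x \<in> space M" "y \<in> space M" "z \<in> space M"
      by (auto simp: space_pair_measure)
    have *: "ln (U (x, y, z)) = ln (?R q x y) + ln (?R (Suc i) x z) - ln (cyc q x) - ln (?R i y z)"
      using kpow_pos[of x y q] kpow_pos[of x z "Suc i"] cyc_pos[of x q] kpow_pos[of y z i] p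
      by (simp add: U_def ln_mult ln_div del: kpow.simps)
    show "T p * ln (U p) = t1 p + t2 p - t3 p - t4 p"
      unfolding p(1) t1_def t2_def t3_def t4_def prod.case * by (simp add: algebra_simps del: kpow.simps)
  qed
  also have "\<dots> = arc_ent q q + arc_ent q (Suc i) - cyc_ent q - arc_ent q i"
    using P.bmeas_integrable[OF b(1)] P.bmeas_integrable[OF b(2)] P.bmeas_integrable[OF b(3)]
      P.bmeas_integrable[OF b(4)] by (simp add: i1 i2 i3 i4)
  finally show ?thesis by simp
qed

text \<open>Telescopes \<open>arc_ent_step\<close> over \<open>i < q\<close>. It compares the closed
  walk, with one edge deleted, to the Markov chain on \<open>q + 1\<close> edges having the same
  edge law: the chain has at least as much entropy.\<close>

lemma cyc_chain_rule: "real (Suc q) * arc_ent q q - real q * cyc_ent q \<le> arc_ent q 0"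
proof -
  have "real i * (arc_ent q q - cyc_ent q) + arc_ent q i \<le> arc_ent q 0" if "i \<le> q" for i
    using that
  proof (induction i)
    case (Suc i)
    then show ?case using arc_ent_step[of i q] by (simp add: algebra_simps)
  qed simp
  from this[of q] show ?thesis by (simp add: algebra_simps)
qed


text \<open>Holds because \<open>K \<le> 1\<close>; it allows the weight of the deleted edge to be
  dropped from \<open>cyc_chain_rule\<close>.\<close>

lemma arc_ent_nonpos: "arc_ent q 0 \<le> 0"
proof -
  have "(\<integral>y. kpow M K q x y * K x y * ln (K x y) \<partial>M) \<le> 0" if x: "x \<in> space M" for x
  proof (rule integral_le_const)
    show "kpow M K q x y * K x y * ln (K x y) \<le> 0" if y: "y \<in> space M" for y
      using kpow_pos[OF x y, of q] K_pos[OF x y] K_le[OF x y]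
      by (intro mult_nonneg_nonpos) auto
    show "bmeas M (\<lambda>y. kpow M K q x y * K x y * ln (K x y))"
      using x by (auto intro!: bmeas_mult bmeas_K' bmeas_kpow' bmeas_ln_K')
  qed
  moreover have "bmeas M (\<lambda>x. \<integral>y. kpow M K q x y * K x y * ln (K x y) \<partial>M)"
    by (auto intro!: bmeas_integral bmeas_pairI bmeas_mult bmeas_K' bmeas_kpow' bmeas_ln_K')
  ultimately show ?thesis
    unfolding arc_ent_def by (simp add: integral_le_const)
qed

text \<open>For \<open>q \<ge> 1\<close> this is the density of the cycle with \<open>q + 2\<close>
  edges. At even arguments \<open>2 * j\<close>, including 0, it is also the squared
  Hilbert--Schmidt norm of the \<open>(j + 1)\<close>-step kernel.\<close>

definition cyc_mass :: "nat \<Rightarrow> real" where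
  "cyc_mass q = (\<integral>x. cyc q x \<partial>M)"

lemma cyc_mass_pos: "0 < cyc_mass q"
proof -
  have "d ^ Suc (Suc q) \<le> cyc_mass q"
    unfolding cyc_mass_def by (rule integral_ge_const[OF bmeas_cyc cyc_ge])
  then show ?thesis using d_pos by (meson less_le_trans zero_less_power)
qed

text \<open>Nonpositivity of the entropy of one vertex, used to extrapolate to paths with more than
  \<open>q + 1\<close> edges.\<close>

lemma cyc_mass_ent: "cyc_mass q * ln (cyc_mass q) \<le> cyc_ent q"
  unfolding cyc_ent_def
  using d_pos cyc_ge by (intro entropy_ge[where d = "d ^ Suc (Suc q)"] bmeas_cyc) (auto simp: cyc_mass_def)

text \<open>The unnormalised law of an edge of a random closed walk. It is symmetric because the
  walk can be reversed, hence admissible as the edge law \<open>N\<close> in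
  \<open>walk_entropy\<close>.\<close>

lemma kernel_cyc: "kernel M (\<lambda>x y. K x y * kpow M K q x y) (d * d ^ Suc q)"
proof
  have "bmeas (M \<Otimes>\<^sub>M M) (\<lambda>(x, y). K x y * kpow M K q x y)"
    by (auto intro!: bmeas_pairI bmeas_mult bmeas_K' bmeas_kpow')
  then show "(\<lambda>(x, y). K x y * kpow M K q x y) \<in> borel_measurable (M \<Otimes>\<^sub>M M)"
    by (simp add: bmeas_def)
  show "0 < d * d ^ Suc q" using d_pos by simp
  fix x y assume xy: "x \<in> space M" "y \<in> space M"
  show "d * d ^ Suc q \<le> K x y * kpow M K q x y"
    using xy K_ge K_pos kpow_ge d_pos by (intro mult_mono) (auto intro: less_imp_le simp del: power_Suc)
  have "K x y * kpow M K q x y \<le> 1 * 1"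
    using xy K_le kpow_le kpow_pos by (intro mult_mono) (auto intro: less_imp_le)
  then show "K x y * kpow M K q x y \<le> 1" by simp
  show "K x y * kpow M K q x y = K y x * kpow M K q y x"
    using xy K_sym kpow_sym by simp
qed

lemma integral_cyc_edge:
  assumes "x \<in> space M"
  shows "(\<integral>y. K x y * kpow M K q x y \<partial>M) = cyc q x"
  using cyc_eq[OF assms, of 0 q q] by simp

text \<open>Subadditivity of entropy for the two ends of an edge: Jensen's inequality for
  \<open>U\<close>, the product of the two vertex marginals divided by the edge density
  \<open>T\<close>.\<close>

lemma cyc_vertex_ent: "2 * cyc_ent q - arc_ent q 0 - arc_ent q q \<le> cyc_mass q * ln (cyc_mass q)"
proof -
  interpret N: kernel M "\<lambda>x y. K x y * kpow M K q x y" "d * d ^ Suc q" by (rule kernel_cyc)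
  interpret P: prob_space "M \<Otimes>\<^sub>M M" by (rule prob_space_pair_self)
  note fubini = integral_pair_fst[OF prob_space_axioms prob_space_axioms, symmetric]
  define T where "T p = K (fst p) (snd p) * kpow M K q (fst p) (snd p)" for p
  define U where "U p = cyc q (fst p) * cyc q (snd p) / T p" for p
  have T: "bmeas (M \<Otimes>\<^sub>M M) T"
    unfolding T_def by (auto intro!: bmeas_mult bmeas_K' bmeas_kpow')
  have T_ge: "d * d ^ Suc q \<le> T p" if "p \<in> space (M \<Otimes>\<^sub>M M)" for p
    using that N.K_ge by (auto simp: T_def space_pair_measure)
  have T_pos: "0 < T p" if "p \<in> space (M \<Otimes>\<^sub>M M)" for p
    using T_ge[OF that] N.d_pos by linarith
  have T_le: "T p \<le> 1" if "p \<in> space (M \<Otimes>\<^sub>M M)" for p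
    using that N.K_le by (auto simp: T_def space_pair_measure)
  have U: "bmeas (M \<Otimes>\<^sub>M M) U"
    unfolding U_def
    by (rule bmeas_divide[OF _ T N.d_pos T_ge]) (auto intro!: bmeas_mult bmeas_cyc')
  have U_ge: "d ^ Suc (Suc q) * d ^ Suc (Suc q) \<le> U p" if p: "p \<in> space (M \<Otimes>\<^sub>M M)" for p
  proof -
    have xy: "fst p \<in> space M" "snd p \<in> space M" using p by (auto simp: space_pair_measure)
    have "d ^ Suc (Suc q) * d ^ Suc (Suc q) \<le> cyc q (fst p) * cyc q (snd p)"
      using xy cyc_ge cyc_pos d_pos by (intro mult_mono) (auto intro: less_imp_le simp del: power_Suc)
    also have "\<dots> \<le> U p"
      using T_pos[OF p] T_le[OF p] cyc_pos[OF xy(1), of q] cyc_pos[OF xy(2), of q]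
      by (simp add: U_def le_divide_eq mult_left_le)
    finally show ?thesis .
  qed
  have T_int: "(\<integral>p. T p \<partial>(M \<Otimes>\<^sub>M M)) = cyc_mass q"
  proof -
    have "T = (\<lambda>(x, y). K x y * kpow M K q x y)" by (auto simp: T_def)
    then have "(\<integral>p. T p \<partial>(M \<Otimes>\<^sub>M M)) = (\<integral>x. \<integral>y. K x y * kpow M K q x y \<partial>M \<partial>M)"
      using integral_pair_fst[OF prob_space_axioms prob_space_axioms N.bmeas_K] by simp
    then show ?thesis
      unfolding cyc_mass_def using integral_cyc_edge by (simp cong: Bochner_Integration.integral_cong)
  qed
  have TU_int: "(\<integral>p. T p * U p \<partial>(M \<Otimes>\<^sub>M M)) = cyc_mass q * cyc_mass q"
  proof -
    have "(\<integral>p. T p * U p \<partial>(M \<Otimes>\<^sub>M M)) = (\<integral>p. cyc q (fst p) * cyc q (snd p) \<partial>(M \<Otimes>\<^sub>M M))"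
    proof (intro Bochner_Integration.integral_cong refl)
      show "T p * U p = cyc q (fst p) * cyc q (snd p)" if "p \<in> space (M \<Otimes>\<^sub>M M)" for p
        using T_pos[OF that] by (simp add: U_def)
    qed
    also have "\<dots> = (\<integral>x. \<integral>y. cyc q x * cyc q y \<partial>M \<partial>M)"
      by (subst fubini) (auto simp: case_prod_beta' intro!: bmeas_mult bmeas_cyc')
    finally show ?thesis by (simp add: cyc_mass_def)
  qed
  have b: "bmeas (M \<Otimes>\<^sub>M M) (\<lambda>p. T p * ln (cyc q (fst p)))"
    "bmeas (M \<Otimes>\<^sub>M M) (\<lambda>p. T p * ln (cyc q (snd p)))"
    "bmeas (M \<Otimes>\<^sub>M M) (\<lambda>p. T p * ln (kpow M K 0 (fst p) (snd p)))"
    "bmeas (M \<Otimes>\<^sub>M M) (\<lambda>p. T p * ln (kpow M K q (fst p) (snd p)))"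
    by (auto intro!: bmeas_mult T bmeas_ln_cyc' bmeas_ln_kpow' simp del: kpow.simps)
  have i1: "(\<integral>p. T p * ln (cyc q (fst p)) \<partial>(M \<Otimes>\<^sub>M M)) = cyc_ent q"
  proof -
    have "(\<integral>p. T p * ln (cyc q (fst p)) \<partial>(M \<Otimes>\<^sub>M M))
        = (\<integral>x. \<integral>y. K x y * kpow M K q x y * ln (cyc q x) \<partial>M \<partial>M)"
      using b(1) by (subst fubini) (simp_all add: T_def case_prod_beta')
    then show ?thesis
      unfolding cyc_ent_def using integral_cyc_edge by (simp cong: Bochner_Integration.integral_cong)
  qed
  have i2: "(\<integral>p. T p * ln (cyc q (snd p)) \<partial>(M \<Otimes>\<^sub>M M)) = cyc_ent q"
  proof -
    have "(\<integral>p. T p * ln (cyc q (snd p)) \<partial>(M \<Otimes>\<^sub>M M))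
        = (\<integral>y. \<integral>x. K x y * kpow M K q x y * ln (cyc q y) \<partial>M \<partial>M)"
      using b(2) by (subst integral_pair_snd[OF prob_space_axioms prob_space_axioms, symmetric])
        (simp_all add: T_def case_prod_beta')
    also have "\<dots> = (\<integral>y. cyc q y * ln (cyc q y) \<partial>M)"
    proof (intro Bochner_Integration.integral_cong refl)
      fix y assume y: "y \<in> space M"
      have "(\<integral>x. K x y * kpow M K q x y \<partial>M) = (\<integral>x. K y x * kpow M K q y x \<partial>M)"
        using y N.K_sym by (intro Bochner_Integration.integral_cong) auto
      then show "(\<integral>x. K x y * kpow M K q x y * ln (cyc q y) \<partial>M) = cyc q y * ln (cyc q y)"
        using integral_cyc_edge[OF y] by simp
    qed
    finally show ?thesis by (simp add: cyc_ent_def)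
  qed
  have i3: "(\<integral>p. T p * ln (kpow M K 0 (fst p) (snd p)) \<partial>(M \<Otimes>\<^sub>M M)) = arc_ent q 0"
    unfolding arc_ent_def
    using b(3) by (subst fubini) (simp_all add: T_def case_prod_beta' mult_ac)
  have i4: "(\<integral>p. T p * ln (kpow M K q (fst p) (snd p)) \<partial>(M \<Otimes>\<^sub>M M)) = arc_ent q q"
    unfolding arc_ent_def
    using b(4) by (subst fubini) (simp_all add: T_def case_prod_beta' mult_ac)
  have "(\<integral>p. T p * ln (U p) \<partial>(M \<Otimes>\<^sub>M M)) \<le> cyc_mass q * ln (cyc_mass q * cyc_mass q / cyc_mass q)"
    by (rule P.jensen_ln[OF T U _ _ U_ge T_int cyc_mass_pos TU_int])
      (use T_pos d_pos in \<open>auto intro: less_imp_le\<close>)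
  also have "(\<integral>p. T p * ln (U p) \<partial>(M \<Otimes>\<^sub>M M))
      = (\<integral>p. T p * ln (cyc q (fst p)) + T p * ln (cyc q (snd p))
          - T p * ln (kpow M K 0 (fst p) (snd p)) - T p * ln (kpow M K q (fst p) (snd p)) \<partial>(M \<Otimes>\<^sub>M M))"
  proof (intro Bochner_Integration.integral_cong refl)
    fix p assume "p \<in> space (M \<Otimes>\<^sub>M M)"
    then obtain x y where p: "p = (x, y)" "x \<in> space M" "y \<in> space M"
      by (auto simp: space_pair_measure)
    have *: "ln (U (x, y)) = ln (cyc q x) + ln (cyc q y) - ln (K x y) - ln (kpow M K q x y)"
      using kpow_pos[of x y q] K_pos[of x y] cyc_pos[of x q] cyc_pos[of y q] p
      by (simp add: U_def T_def ln_mult ln_div)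
    show "T p * ln (U p) = T p * ln (cyc q (fst p)) + T p * ln (cyc q (snd p))
          - T p * ln (kpow M K 0 (fst p) (snd p)) - T p * ln (kpow M K q (fst p) (snd p))"
      unfolding p(1) fst_conv snd_conv kpow.simps(1) * by (simp add: algebra_simps)
  qed
  also have "\<dots> = cyc_ent q + cyc_ent q - arc_ent q 0 - arc_ent q q"
    using P.bmeas_integrable[OF b(1)] P.bmeas_integrable[OF b(2)] P.bmeas_integrable[OF b(3)]
      P.bmeas_integrable[OF b(4)] by (simp add: i1 i2 i3[simplified] i4)
  finally show ?thesis using cyc_mass_pos[of q] by simp
qed

section \<open>Lower bounds for walk counts in terms of closed walks\<close>

text \<open>\<open>walk_entropy\<close> for the edge law of the closed walk: its vertex marginal is
  \<open>cyc q\<close>, and \<open>ln (K x y)\<close> cancels in the edge term, leaving the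
  logarithm of the complementary arc only.\<close>

lemma cyc_walk_entropy:
  "cyc_mass q * ln (cyc_mass q) - real n * arc_ent q q + (real n - 1) * cyc_ent q
     \<le> cyc_mass q * ln (\<integral>x. walk M K n x \<partial>M)"
proof -
  have w: "walk M (\<lambda>x y. K x y * kpow M K q x y) 1 x = cyc q x" if "x \<in> space M" for x
    using integral_cyc_edge[OF that] by simp
  have mass: "(\<integral>x. walk M (\<lambda>x y. K x y * kpow M K q x y) 1 x \<partial>M) = cyc_mass q"
    unfolding cyc_mass_def using w by (intro Bochner_Integration.integral_cong) auto
  have ent: "(\<integral>x. walk M (\<lambda>x y. K x y * kpow M K q x y) 1 x
      * ln (walk M (\<lambda>x y. K x y * kpow M K q x y) 1 x) \<partial>M) = cyc_ent q"
    unfolding cyc_ent_def using w by (intro Bochner_Integration.integral_cong) auto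
  have "(\<integral>x. \<integral>y. K x y * kpow M K q x y * (ln (K x y) - ln (K x y * kpow M K q x y)) \<partial>M \<partial>M)
      = (\<integral>x. \<integral>y. - (K x y * kpow M K q x y * ln (kpow M K q x y)) \<partial>M \<partial>M)"
  proof (intro Bochner_Integration.integral_cong refl)
    fix x y assume "x \<in> space M" "y \<in> space M"
    then show "K x y * kpow M K q x y * (ln (K x y) - ln (K x y * kpow M K q x y))
        = - (K x y * kpow M K q x y * ln (kpow M K q x y))"
      using K_pos[of x y] kpow_pos[of x y q] by (simp add: ln_mult)
  qed
  also have "\<dots> = - arc_ent q q" by (simp add: arc_ent_def)
  finally have A: "(\<integral>x. \<integral>y. K x y * kpow M K q x y * (ln (K x y) - ln (K x y * kpow M K q x y)) \<partial>M \<partial>M)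
      = - arc_ent q q" .
  show ?thesis
    using walk_entropy[OF kernel_cyc, of q n] unfolding mass ent A by simp
qed

text \<open>The cycle has \<open>m = q + 2\<close> edges, so \<open>Suc q\<close> is
  \<open>m - 1\<close>, the length at which the chain bound reaches the cycle density.\<close>

lemma walk_ge_cyc_long:
  assumes "Suc q \<le> n"
  shows "real n / real (Suc q) * ln (cyc_mass q) \<le> ln (\<integral>x. walk M K n x \<partial>M)"
proof -
  define k where "k = real (Suc q)"
  have "0 < k" "k \<le> real n" "real q = k - 1" using assms by (auto simp: k_def)
  then show ?thesis
    using long_path_arith[where k = k and n = n and c = "cyc_mass q" and L = "ln (cyc_mass q)"
        and F = "arc_ent q q" and B = "cyc_ent q"]
      cyc_walk_entropy[of q n] cyc_chain_rule[of q] arc_ent_nonpos[of q] cyc_mass_ent[of q]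
      cyc_mass_pos[of q]
    unfolding k_def[symmetric] by simp
qed

lemma walk_ge_cyc_short:
  assumes "n \<le> Suc q"
  shows "real (Suc n) / real (Suc (Suc q)) * ln (cyc_mass q) \<le> ln (\<integral>x. walk M K n x \<partial>M)"
proof -
  define k where "k = real (Suc q)"
  have k: "0 < k" "real n \<le> k" "real q = k - 1" "real (Suc (Suc q)) = k + 1" "real (Suc n) = real n + 1"
    using assms by (auto simp: k_def)
  show ?thesis
    using short_path_arith[where k = k and n = n and c = "cyc_mass q" and L = "ln (cyc_mass q)"
        and F = "arc_ent q q" and B = "cyc_ent q" and E = "arc_ent q 0"]
      cyc_walk_entropy[of q n] cyc_chain_rule[of q] arc_ent_nonpos[of q] cyc_vertex_ent[of q]
      cyc_mass_pos[of q] k(1,2)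
    unfolding k(3-5) k_def[symmetric] by simp
qed


end

section \<open>Walks and even cycles\<close>

context kernel
begin

lemma integral_kpow_sq:
  assumes "x \<in> space M"
  shows "(\<integral>y. (kpow M K j x y)\<^sup>2 \<partial>M) = cyc (2 * j) x"
  using cyc_eq[OF assms, of j j "2 * j"] by (simp add: power2_eq_square)

lemma kpow_sq_pos: "x \<in> space M \<Longrightarrow> 0 < (\<integral>y. (kpow M K j x y)\<^sup>2 \<partial>M)"
  using integral_kpow_sq cyc_pos by simp

lemma cyc_mass_eq: "cyc_mass (2 * j) = (\<integral>x. \<integral>y. (kpow M K j x y)\<^sup>2 \<partial>M \<partial>M)"
  unfolding cyc_mass_def using integral_kpow_sq by (simp cong: Bochner_Integration.integral_cong)

text \<open>Cauchy--Schwarz over the intermediate vertex bounds the squared composed kernel by a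
  function of \<open>x\<close> times a function of \<open>y\<close>; integration then
  factorises.\<close>

lemma cyc_mass_submult: "cyc_mass (2 * Suc (i + j)) \<le> cyc_mass (2 * i) * cyc_mass (2 * j)"
proof -
  have "(kpow M K (Suc (i + j)) x y)\<^sup>2 \<le> cyc (2 * i) x * cyc (2 * j) y"
    if xy: "x \<in> space M" "y \<in> space M" for x y
  proof -
    have "kpow M K (Suc (i + j)) x y = (\<integral>z. kpow M K i x z * kpow M K j y z \<partial>M)"
      unfolding kpow_comp[OF xy, symmetric]
      using xy kpow_sym by (intro Bochner_Integration.integral_cong) auto
    also have "\<dots>\<^sup>2 \<le> (\<integral>z. (kpow M K i x z)\<^sup>2 \<partial>M) * (\<integral>z. (kpow M K j y z)\<^sup>2 \<partial>M)"
      using xy kpow_sq_pos by (intro cauchy_schwarz) (auto intro!: bmeas_kpow')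
    finally show ?thesis using xy by (simp add: integral_kpow_sq)
  qed
  then have "(\<integral>x. \<integral>y. (kpow M K (Suc (i + j)) x y)\<^sup>2 \<partial>M \<partial>M)
      \<le> (\<integral>x. \<integral>y. cyc (2 * i) x * cyc (2 * j) y \<partial>M \<partial>M)"
    unfolding power2_eq_square
    by (intro integral_mono bmeas_integrable)
      (auto intro!: bmeas_mult bmeas_integral bmeas_pairI bmeas_kpow' bmeas_cyc' simp del: kpow.simps)
  then show ?thesis
    unfolding cyc_mass_eq by (simp add: integral_kpow_sq cyc_mass_def del: kpow.simps cong: Bochner_Integration.integral_cong)
qed

text \<open>The index \<open>j + Suc j * r\<close> stands for \<open>(j + 1) * (r + 1)\<close>
  steps, that is, \<open>r + 1\<close> blocks of \<open>j + 1\<close> steps.\<close>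

lemma cyc_mass_power: "cyc_mass (2 * (j + Suc j * r)) \<le> cyc_mass (2 * j) ^ Suc r"
proof (induction r)
  case 0
  then show ?case by simp
next
  case (Suc r)
  have "cyc_mass (2 * (j + Suc j * Suc r)) = cyc_mass (2 * Suc (j + (j + Suc j * r)))"
    by (simp add: algebra_simps)
  also have "\<dots> \<le> cyc_mass (2 * j) * cyc_mass (2 * (j + Suc j * r))"
    by (rule cyc_mass_submult)
  also have "\<dots> \<le> cyc_mass (2 * j) * cyc_mass (2 * j) ^ Suc r"
    using Suc cyc_mass_pos[of "2 * j"] by (intro mult_left_mono) auto
  finally show ?case by simp
qed

text \<open>Cauchy--Schwarz against the constant 1, once in each end point of the walk.\<close>

lemma walk_sq_le: "(\<integral>x. walk M K (Suc j) x \<partial>M)\<^sup>2 \<le> cyc_mass (2 * j)"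
proof -
  have one: "0 < (\<integral>x. (1 :: real)\<^sup>2 \<partial>M)" by (simp add: prob_space)
  have "(walk M K (Suc j) x)\<^sup>2 \<le> cyc (2 * j) x" if x: "x \<in> space M" for x
    using cauchy_schwarz[of "kpow M K j x" "\<lambda>_. 1"] one x bmeas_const[of M 1]
    by (simp add: integral_kpow integral_kpow_sq bmeas_kpow' prob_space del: walk.simps)
  then have "(\<integral>x. (walk M K (Suc j) x)\<^sup>2 \<partial>M) \<le> (\<integral>x. cyc (2 * j) x \<partial>M)"
    unfolding power2_eq_square
    by (intro integral_mono bmeas_integrable bmeas_mult bmeas_walk bmeas_cyc) auto
  moreover have "(\<integral>x. walk M K (Suc j) x \<partial>M)\<^sup>2 \<le> (\<integral>x. (walk M K (Suc j) x)\<^sup>2 \<partial>M)"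
    using cauchy_schwarz[OF bmeas_walk bmeas_const, of 1 "Suc j"] one
    by (simp add: prob_space del: walk.simps)
  ultimately show ?thesis by (simp add: cyc_mass_def)
qed

lemma walk_mass_pos: "0 < (\<integral>x. walk M K n x \<partial>M)"
proof -
  have "d ^ n \<le> (\<integral>x. walk M K n x \<partial>M)"
    using walk_bounds by (intro integral_ge_const bmeas_walk) auto
  then show ?thesis using d_pos by (meson less_le_trans zero_less_power)
qed

text \<open>\<open>walk_entropy\<close> for the \<open>(j + 1)\<close>-step kernel with that kernel
  itself as edge law: the edge term \<open>A\<close> vanishes, and \<open>entropy_ge\<close> bounds
  the vertex term.\<close>

lemma walk_supermult:
  assumes "n \<ge> 1"
  shows "real n * ln (\<integral>x. walk M K (Suc j) x \<partial>M) \<le> ln (\<integral>x. walk M K (Suc j * n) x \<partial>M)"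
proof -
  interpret R: kernel M "kpow M K j" "d ^ Suc j" by (rule kernel_kpow)
  define c where "c = (\<integral>x. walk M K (Suc j) x \<partial>M)"
  have mass: "(\<integral>x. walk M (kpow M K j) n x \<partial>M) = (\<integral>x. walk M K (Suc j * n) x \<partial>M)" for n
    by (intro Bochner_Integration.integral_cong refl walk_kpow)
  have mass1: "(\<integral>x. walk M (kpow M K j) 1 x \<partial>M) = c"
    using mass[of 1] by (simp add: c_def del: walk.simps)
  have "c * ln c + real n * 0
      + (real n - 1) * (\<integral>x. walk M (kpow M K j) 1 x * ln (walk M (kpow M K j) 1 x) \<partial>M)
      \<le> c * ln (\<integral>x. walk M (kpow M K j) n x \<partial>M)"
    using R.walk_entropy[OF kernel_kpow, of j n] unfolding mass1 by simp
  moreover have "c * ln c \<le> (\<integral>x. walk M (kpow M K j) 1 x * ln (walk M (kpow M K j) 1 x) \<partial>M)"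
    using R.d_pos R.walk_bounds[of _ 1] mass1
    by (intro entropy_ge[where d = "d ^ Suc j"] R.bmeas_walk) auto
  then have "(real n - 1) * (c * ln c)
      \<le> (real n - 1) * (\<integral>x. walk M (kpow M K j) 1 x * ln (walk M (kpow M K j) 1 x) \<partial>M)"
    using assms by (intro mult_left_mono) auto
  ultimately have "c * ln c + (real n - 1) * (c * ln c) \<le> c * ln (\<integral>x. walk M (kpow M K j) n x \<partial>M)"
    by linarith
  then have "c * (real n * ln c) \<le> c * ln (\<integral>x. walk M (kpow M K j) n x \<partial>M)"
    by (simp add: algebra_simps)
  moreover have "c > 0" unfolding c_def by (rule walk_mass_pos)
  ultimately show ?thesis unfolding mass by (simp add: c_def del: walk.simps)
qed

text \<open>A walk of \<open>Suc m * Suc n\<close> steps is read in two ways: as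
  \<open>Suc n\<close> blocks of length \<open>Suc m\<close> for the path bound, and as
  \<open>Suc m\<close> blocks of length \<open>Suc n\<close> for the norm bound.\<close>

lemma even_cyc_ge_walk:
  "2 * real (Suc n) / real (Suc m) * ln (\<integral>x. walk M K (Suc m) x \<partial>M) \<le> ln (cyc_mass (2 * n))"
proof -
  let ?a = "\<integral>x. walk M K (Suc m) x \<partial>M" and ?b = "\<integral>x. walk M K (Suc m * Suc n) x \<partial>M"
  have idx: "Suc m * Suc n = Suc (n + Suc n * m)" by simp
  have "?b\<^sup>2 \<le> cyc_mass (2 * (n + Suc n * m))"
    unfolding idx by (rule walk_sq_le)
  also have "\<dots> \<le> cyc_mass (2 * n) ^ Suc m" by (rule cyc_mass_power)
  finally have "ln (?b\<^sup>2) \<le> ln (cyc_mass (2 * n) ^ Suc m)"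
    using walk_mass_pos[of "Suc m * Suc n"] cyc_mass_pos[of "2 * n"]
    by (subst ln_le_cancel_iff) (auto simp del: walk.simps mult_Suc mult_Suc_right)
  then have "2 * ln ?b \<le> real (Suc m) * ln (cyc_mass (2 * n))"
    using walk_mass_pos[of "Suc m * Suc n"] cyc_mass_pos[of "2 * n"]
    by (simp add: ln_realpow del: walk.simps mult_Suc mult_Suc_right power_Suc of_nat_Suc)
  moreover have "real (Suc n) * ln ?a \<le> ln ?b" by (rule walk_supermult) simp
  ultimately have "2 * real (Suc n) * ln ?a \<le> real (Suc m) * ln (cyc_mass (2 * n))" by linarith
  then show ?thesis by (simp add: pos_divide_le_eq mult.commute del: walk.simps of_nat_Suc)
qed

section \<open>Homomorphism densities of paths and cycles\<close>

lemma bmeas_PiM_walk: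
  assumes "bmeas (M \<Otimes>\<^sub>M M) (\<lambda>(x, y). g x y)"
  shows "bmeas (PiM {..n} (\<lambda>_. M)) (\<lambda>x. (\<Prod>i<n. K (x i) (x (Suc i))) * g (x 0) (x n))"
  by (auto intro!: bmeas_mult bmeas_prod bmeas_K' bmeas_compose2[OF assms] measurable_component_singleton)

lemma integral_PiM_step:
  assumes g: "bmeas (M \<Otimes>\<^sub>M M) (\<lambda>(x, y). g x y)"
  shows "(\<integral>x. (\<Prod>i<Suc n. K (x i) (x (Suc i))) * g (x 0) (x (Suc n)) \<partial>PiM {..Suc n} (\<lambda>_. M))
    = (\<integral>x. (\<Prod>i<n. K (x i) (x (Suc i))) * (\<integral>y. K (x n) y * g (x 0) y \<partial>M) \<partial>PiM {..n} (\<lambda>_. M))"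
proof -
  interpret product_sigma_finite "\<lambda>_::nat. M"
    by standard
  have "prob_space (PiM {..Suc n} (\<lambda>_. M))"
    by (intro prob_space_PiM prob_space_axioms)
  then have int: "integrable (PiM (insert (Suc n) {..n}) (\<lambda>_. M))
      (\<lambda>x. (\<Prod>i<Suc n. K (x i) (x (Suc i))) * g (x 0) (x (Suc n)))"
    using prob_space.bmeas_integrable[OF _ bmeas_PiM_walk[OF g, of "Suc n"]] by (simp only: atMost_Suc)
  show ?thesis
    unfolding atMost_Suc
    by (subst product_integral_insert[OF _ _ int]) (auto simp: mult.assoc intro!: Bochner_Integration.integral_cong)
qed

text \<open>The factor \<open>g\<close> on the two end points serves both graphs:
  \<open>g = 1\<close> gives a path, and \<open>g = K\<close> adds the edge that closes a
  cycle.\<close>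

lemma integral_PiM_walk:
  assumes "bmeas (M \<Otimes>\<^sub>M M) (\<lambda>(x, y). g x y)"
  shows "(\<integral>x. (\<Prod>i<Suc n. K (x i) (x (Suc i))) * g (x 0) (x (Suc n)) \<partial>PiM {..Suc n} (\<lambda>_. M))
    = (\<integral>x. \<integral>y. kpow M K n x y * g x y \<partial>M \<partial>M)"
  using assms
proof (induction n arbitrary: g)
  case (0 g)
  interpret product_sigma_finite "\<lambda>_::nat. M"
    by standard
  note g' = bmeas_compose2[OF 0]
  have b: "bmeas M (\<lambda>x. \<integral>y. K x y * g x y \<partial>M)"
    by (auto intro!: bmeas_integral bmeas_pairI bmeas_mult bmeas_K' g')
  have "{..0::nat} = {0}" by auto
  then show ?case
    unfolding integral_PiM_step[OF 0]
    using product_integral_singleton[of "\<lambda>x. \<integral>y. K x y * g x y \<partial>M" 0] b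
    by (simp add: bmeas_def)
next
  case (Suc n g)
  note g' = bmeas_compose2[OF Suc.prems]
  \<comment> \<open>Integrating out the last vertex replaces \<open>g\<close> by this function of
    the first and the new last vertex, which is why the induction needs arbitrary
    \<open>g\<close>.\<close>
  have b: "bmeas (M \<Otimes>\<^sub>M M) (\<lambda>(x, z). \<integral>y. K z y * g x y \<partial>M)"
    by (auto intro!: bmeas_integral bmeas_pairI bmeas_mult bmeas_K' g')
  have "(\<integral>y. kpow M K n x y * (\<integral>z. K y z * g x z \<partial>M) \<partial>M) = (\<integral>y. kpow M K (Suc n) x y * g x y \<partial>M)"
    if x: "x \<in> space M" for x
  proof -
    have "(\<integral>y. kpow M K n x y * (\<integral>z. K y z * g x z \<partial>M) \<partial>M)
        = (\<integral>y. \<integral>z. kpow M K n x y * (K y z * g x z) \<partial>M \<partial>M)"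
      by simp
    also have "\<dots> = (\<integral>z. \<integral>y. kpow M K n x y * (K y z * g x z) \<partial>M \<partial>M)"
      using x by (intro integral_swap) (auto intro!: bmeas_pairI bmeas_mult bmeas_K' bmeas_kpow' g')
    also have "\<dots> = (\<integral>z. kpow M K (Suc n) x z * g x z \<partial>M)"
    proof (intro Bochner_Integration.integral_cong refl)
      fix z assume z: "z \<in> space M"
      have "(\<integral>y. kpow M K n x y * (K y z * g x z) \<partial>M) = (\<integral>y. g x z * (kpow M K n x y * kpow M K 0 y z) \<partial>M)"
        by (simp add: mult_ac)
      also have "\<dots> = kpow M K (Suc n) x z * g x z"
        unfolding integral_mult_right_zero kpow_comp[OF x z] by simp
      finally show "(\<integral>y. kpow M K n x y * (K y z * g x z) \<partial>M) = kpow M K (Suc n) x z * g x z" .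
    qed
    finally show ?thesis .
  qed
  note * = this
  show ?case
    unfolding integral_PiM_step[OF Suc.prems] Suc.IH[OF b]
    by (rule Bochner_Integration.integral_cong[OF refl], rule *)
qed

end


lemma prob_space_unit_interval: "prob_space unit_interval"
  by (intro prob_space_restrict_space) auto

lemma space_unit_interval: "space unit_interval = {0..1}"
  by (simp add: space_restrict_space)

lemma path_edge_prod:
  fixes f :: "nat \<Rightarrow> nat \<Rightarrow> 'b :: comm_monoid_mult"
  shows "(\<Prod>e\<in>snd (path_graph l). f (Min e) (Max e)) = (\<Prod>i<l. f i (Suc i))"
proof -
  have "inj_on (\<lambda>i. {i, Suc i}) {..<l}"
    by (auto simp: inj_on_def doubleton_eq_iff)
  then show ?thesis by (simp add: path_graph_def prod.reindex)
qed

lemma cycle_edges: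
  "snd (cycle_graph (Suc l)) = insert {0, l} (snd (path_graph l))"
proof -
  \<comment> \<open>Only the index \<open>l\<close> wraps around; it contributes the edge
    \<open>{0, l}\<close>.\<close>
  have "(\<lambda>i. {i, Suc i mod Suc l}) ` {..<l} = (\<lambda>i. {i, Suc i}) ` {..<l}"
    by (intro image_cong) auto
  then show ?thesis
    by (auto simp: cycle_graph_def path_graph_def lessThan_Suc)
qed

text \<open>For \<open>l \<ge> 2\<close> the closing edge is not an edge of the path; for
  \<open>l = 1\<close> the two would coincide and the factor would be counted once.\<close>

lemma cycle_edge_prod:
  fixes f :: "nat \<Rightarrow> nat \<Rightarrow> 'b :: comm_monoid_mult"
  assumes "l \<ge> 2"
  shows "(\<Prod>e\<in>snd (cycle_graph (Suc l)). f (Min e) (Max e)) = (\<Prod>i<l. f i (Suc i)) * f 0 l"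
proof -
  have "{0, l} \<notin> snd (path_graph l)" "finite (snd (path_graph l))"
    using assms by (auto simp: path_graph_def doubleton_eq_iff)
  then show ?thesis by (simp add: cycle_edges path_edge_prod mult.commute)
qed

lemma hom_density_path:
  assumes "kernel unit_interval W d"
  shows "hom_density (path_graph (Suc n)) W = (\<integral>x. walk unit_interval W (Suc n) x \<partial>unit_interval)"
proof -
  interpret kernel unit_interval W d by fact
  have "hom_density (path_graph (Suc n)) W
      = (\<integral>x. (\<Prod>i<Suc n. W (x i) (x (Suc i))) * 1 \<partial>PiM {..Suc n} (\<lambda>_. unit_interval))"
    unfolding hom_density_def path_edge_prod[where f = "\<lambda>i j. W (_ i) (_ j)"]
    by (simp add: path_graph_def)
  also have "\<dots> = (\<integral>x. \<integral>y. kpow unit_interval W n x y * 1 \<partial>unit_interval \<partial>unit_interval)"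
    by (rule integral_PiM_walk[of "\<lambda>_ _. 1"]) (intro bmeas_pairI bmeas_const)
  also have "\<dots> = (\<integral>x. walk unit_interval W (Suc n) x \<partial>unit_interval)"
    by (rule Bochner_Integration.integral_cong[OF refl]) (simp add: integral_kpow del: walk.simps)
  finally show ?thesis .
qed

lemma hom_density_cycle:
  assumes "kernel unit_interval W d" "q \<ge> 1"
  shows "hom_density (cycle_graph (Suc (Suc q))) W = kernel.cyc_mass unit_interval W q"
proof -
  interpret kernel unit_interval W d by fact
  have "hom_density (cycle_graph (Suc (Suc q))) W
      = (\<integral>x. (\<Prod>i<Suc q. W (x i) (x (Suc i))) * W (x 0) (x (Suc q)) \<partial>PiM {..Suc q} (\<lambda>_. unit_interval))"
    using assms(2) unfolding hom_density_def
    by (subst cycle_edge_prod[where f = "\<lambda>i j. W (_ i) (_ j)"])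
      (simp_all add: cycle_graph_def lessThan_Suc_atMost)
  also have "\<dots> = (\<integral>x. \<integral>y. kpow unit_interval W q x y * W x y \<partial>unit_interval \<partial>unit_interval)"
    by (rule integral_PiM_walk[OF bmeas_K])
  also have "\<dots> = cyc_mass q"
    unfolding cyc_mass_def
    by (rule Bochner_Integration.integral_cong[OF refl]) (simp add: integral_cyc_edge mult.commute)
  finally show ?thesis .
qed

section \<open>Approximation of graphons by positive kernels\<close>

lemma graphon_le_1: "graphon W \<Longrightarrow> x \<in> {0..1} \<Longrightarrow> y \<in> {0..1} \<Longrightarrow> W x y \<le> 1"
  and graphon_nonneg: "graphon W \<Longrightarrow> x \<in> {0..1} \<Longrightarrow> y \<in> {0..1} \<Longrightarrow> 0 \<le> W x y"
  unfolding graphon_def by blast+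

lemma graphon_max:
  assumes "graphon W" "0 \<le> d" "d \<le> 1"
  shows "graphon (\<lambda>x y. max (W x y) d)"
  using assms unfolding graphon_def by (auto simp: case_prod_beta')

lemma kernel_max:
  assumes "graphon W" "0 < d" "d \<le> 1"
  shows "kernel unit_interval (\<lambda>x y. max (W x y) d) d"
proof -
  interpret prob_space unit_interval by (rule prob_space_unit_interval)
  show ?thesis
    using graphon_max[OF assms(1) _ assms(3)] assms(2) unfolding graphon_def
    by unfold_locales (auto simp: space_unit_interval)
qed

lemma edge_ends:
  assumes "simple_graph G" "e \<in> snd G"
  shows "Min e \<in> fst G" "Max e \<in> fst G"
proof -
  have e: "e \<subseteq> fst G" "card e = 2" using assms by (auto simp: simple_graph_def)
  then have "finite e" "e \<noteq> {}" by (auto intro: card_ge_0_finite)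
  then show "Min e \<in> fst G" "Max e \<in> fst G" using e Min_in Max_in by blast+
qed

lemma PiM_unit_component:
  assumes "x \<in> space (PiM I (\<lambda>_. unit_interval))" "i \<in> I"
  shows "x i \<in> {0..1}"
  using assms space_unit_interval by (auto simp: space_PiM)

lemma edge_factor_measurable:
  assumes "graphon W" "simple_graph G"
  shows "(\<lambda>x. \<Prod>e\<in>snd G. W (x (Min e)) (x (Max e))) \<in> borel_measurable (PiM (fst G) (\<lambda>_. unit_interval))"
proof (rule borel_measurable_prod)
  fix e assume "e \<in> snd G"
  then show "(\<lambda>x. W (x (Min e)) (x (Max e))) \<in> borel_measurable (PiM (fst G) (\<lambda>_. unit_interval))"
    using assms edge_ends unfolding graphon_def
    by (intro measurable_Pair_compose_split[of W unit_interval unit_interval])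
      (auto intro!: measurable_component_singleton)
qed

lemma edge_factor_bounds:
  assumes "graphon W" "simple_graph G" "x \<in> space (PiM (fst G) (\<lambda>_. unit_interval))"
  shows "0 \<le> (\<Prod>e\<in>snd G. W (x (Min e)) (x (Max e)))" "(\<Prod>e\<in>snd G. W (x (Min e)) (x (Max e))) \<le> 1"
proof -
  have "0 \<le> W (x (Min e)) (x (Max e)) \<and> W (x (Min e)) (x (Max e)) \<le> 1" if "e \<in> snd G" for e
    using assms edge_ends[OF assms(2) that] PiM_unit_component[OF assms(3)]
    by (simp add: graphon_le_1 graphon_nonneg)
  then show "0 \<le> (\<Prod>e\<in>snd G. W (x (Min e)) (x (Max e)))" "(\<Prod>e\<in>snd G. W (x (Min e)) (x (Max e))) \<le> 1"
    by (auto intro: prod_nonneg prod_le_1)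
qed

lemma bmeas_edge_factor:
  assumes "graphon W" "simple_graph G"
  shows "bmeas (PiM (fst G) (\<lambda>_. unit_interval)) (\<lambda>x. \<Prod>e\<in>snd G. W (x (Min e)) (x (Max e)))"
  using edge_factor_bounds[OF assms] by (intro bmeasI[OF edge_factor_measurable[OF assms], of 1]) auto

lemma prob_space_PiM_unit: "prob_space (PiM I (\<lambda>_. unit_interval))"
  by (intro prob_space_PiM prob_space_unit_interval)

lemma hom_density_bounds:
  assumes "graphon W" "simple_graph G"
  shows "0 \<le> hom_density G W" "hom_density G W \<le> 1"
  unfolding hom_density_def
  using prob_space.integral_ge_const[OF prob_space_PiM_unit bmeas_edge_factor[OF assms]]
    prob_space.integral_le_const[OF prob_space_PiM_unit bmeas_edge_factor[OF assms]]
    edge_factor_bounds[OF assms] by blast+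

lemma hom_density_mono:
  assumes "graphon V" "graphon W" "simple_graph G"
    and "\<And>x y. x \<in> {0..1} \<Longrightarrow> y \<in> {0..1} \<Longrightarrow> V x y \<le> W x y"
  shows "hom_density G V \<le> hom_density G W"
  unfolding hom_density_def
proof (intro integral_mono prob_space.bmeas_integrable prob_space_PiM_unit bmeas_edge_factor assms(1-3) prod_mono conjI)
  fix x e assume x: "x \<in> space (PiM (fst G) (\<lambda>_. unit_interval))" and e: "e \<in> snd G"
  have "x (Min e) \<in> {0..1}" "x (Max e) \<in> {0..1}"
    using edge_ends[OF assms(3) e] PiM_unit_component[OF x] by blast+
  then show "0 \<le> V (x (Min e)) (x (Max e))" "V (x (Min e)) (x (Max e)) \<le> W (x (Min e)) (x (Max e))"
    using assms graphon_nonneg by blast+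
qed

text \<open>A positive kernel that dominates \<open>W\<close> and tends to it pointwise on the unit
  square; the threshold stays in \<open>(0, 1]\<close>, so the result is still a graphon.\<close>

definition lift_graphon :: "(real \<Rightarrow> real \<Rightarrow> real) \<Rightarrow> nat \<Rightarrow> real \<Rightarrow> real \<Rightarrow> real" where
  "lift_graphon W i x y = max (W x y) (1 / real (Suc i))"

lemma graphon_lift: "graphon W \<Longrightarrow> graphon (lift_graphon W i)"
  using graphon_max[of W "1 / real (Suc i)"] by (simp add: lift_graphon_def[abs_def])

lemma kernel_lift: "graphon W \<Longrightarrow> kernel unit_interval (lift_graphon W i) (1 / real (Suc i))"
  using kernel_max[of W "1 / real (Suc i)"] by (simp add: lift_graphon_def[abs_def])

lemma hom_density_lift_tendsto:
  assumes W: "graphon W" and G: "simple_graph G"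
  shows "(\<lambda>i. hom_density G (lift_graphon W i)) \<longlonglongrightarrow> hom_density G W"
  unfolding hom_density_def
proof (rule integral_dominated_convergence[where w = "\<lambda>_. 1"])
  let ?P = "PiM (fst G) (\<lambda>_. unit_interval)"
  show "integrable ?P (\<lambda>_. 1 :: real)"
    by (intro prob_space.bmeas_integrable prob_space_PiM_unit bmeas_const)
  show "AE x in ?P. (\<lambda>i. \<Prod>e\<in>snd G. lift_graphon W i (x (Min e)) (x (Max e)))
      \<longlonglongrightarrow> (\<Prod>e\<in>snd G. W (x (Min e)) (x (Max e)))"
  proof (intro AE_I2 tendsto_prod)
    fix x e assume x: "x \<in> space ?P" and e: "e \<in> snd G"
    have "x (Min e) \<in> {0..1}" "x (Max e) \<in> {0..1}"
      using edge_ends[OF G e] PiM_unit_component[OF x] by blast+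
    then have "max (W (x (Min e)) (x (Max e))) 0 = W (x (Min e)) (x (Max e))"
      using graphon_nonneg[OF W] by (simp add: max_absorb1)
    moreover have "(\<lambda>i. max (W (x (Min e)) (x (Max e))) (1 / real (Suc i)))
        \<longlonglongrightarrow> max (W (x (Min e)) (x (Max e))) 0"
      by (intro tendsto_max tendsto_const LIMSEQ_Suc lim_1_over_n)
    ultimately show "(\<lambda>i. lift_graphon W i (x (Min e)) (x (Max e))) \<longlonglongrightarrow> W (x (Min e)) (x (Max e))"
      by (simp add: lift_graphon_def)
  qed
  show "AE x in ?P. norm (\<Prod>e\<in>snd G. lift_graphon W i (x (Min e)) (x (Max e))) \<le> 1" for i
    using edge_factor_bounds[OF graphon_lift[OF W] G] by (intro AE_I2) simp
qed (use edge_factor_measurable W G graphon_lift in blast)+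

text \<open>Lifting \<open>W\<close> only increases the density of \<open>G\<close>, so the bound
  for the lifted kernel implies one with the fixed number \<open>hom_density G W\<close> on the
  left; then the density of \<open>H\<close> is taken to the limit.\<close>

lemma exponent_le:
  assumes G: "simple_graph G" and H: "simple_graph H" and c: "0 \<le> c"
    and pos: "\<And>W d. graphon W \<Longrightarrow> kernel unit_interval W d \<Longrightarrow>
      0 < hom_density H W \<and> c * ln (hom_density G W) \<le> ln (hom_density H W)"
  shows "density_domination_exponent G H \<le> ennreal c"
  unfolding density_domination_exponent_def
proof (rule SUP_least)
  fix W assume "W \<in> {W. graphon W \<and> hom_density G W \<noteq> 0 \<and> hom_density G W \<noteq> 1}"
  then have W: "graphon W" and g: "0 < hom_density G W" "hom_density G W < 1"
    using hom_density_bounds[OF _ G] by force+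
  \<comment> \<open>The exponential form survives the limit, where positivity of
    \<open>hom_density H W\<close> is not known yet.\<close>
  have "exp (c * ln (hom_density G W)) \<le> hom_density H (lift_graphon W i)" for i
  proof -
    have "hom_density G W \<le> hom_density G (lift_graphon W i)"
      using W graphon_lift[OF W] G by (intro hom_density_mono) (auto simp: lift_graphon_def)
    then have "c * ln (hom_density G W) \<le> c * ln (hom_density G (lift_graphon W i))"
      using g c by (intro mult_left_mono) auto
    also have "\<dots> \<le> ln (hom_density H (lift_graphon W i))"
      using pos[OF graphon_lift[OF W] kernel_lift[OF W]] by blast
    finally show ?thesis
      using pos[OF graphon_lift[OF W] kernel_lift[OF W]] by (metis exp_le_cancel_iff exp_ln)
  qed
  then have le: "exp (c * ln (hom_density G W)) \<le> hom_density H W"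
    by (intro LIMSEQ_le_const[OF hom_density_lift_tendsto[OF W H]]) auto
  \<comment> \<open>The limit inequality itself excludes the infinite value of the ratio.\<close>
  have h: "0 < hom_density H W" using le by (meson exp_gt_zero less_le_trans)
  then have "c * ln (hom_density G W) \<le> ln (hom_density H W)"
    using le by (simp add: ln_ge_iff)
  then have "ln (hom_density H W) / ln (hom_density G W) \<le> c"
    using g by (simp add: neg_divide_le_eq)
  then show "log_density_ratio G H W \<le> ennreal c"
    using h by (simp add: log_density_ratio_def ennreal_leI)
qed

section \<open>Extremal graphons\<close>

text \<open>Writing both densities as powers of one base turns the logarithmic ratio of the witness
  \<open>W\<close> into \<open>t / s\<close>.\<close>

lemma exponent_ge:
  assumes "graphon W" "hom_density G W = b powr s" "hom_density H W = b powr t"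
    and "0 < b" "b < 1" "0 < s"
  shows "ennreal (t / s) \<le> density_domination_exponent G H"
proof -
  have "b powr s \<noteq> 1" using assms by (simp add: powr_eq_one_iff_gen)
  then have "log_density_ratio G H W \<le> density_domination_exponent G H"
    unfolding density_domination_exponent_def using assms by (intro SUP_upper) auto
  then show ?thesis using assms by (simp add: log_density_ratio_def ln_powr)
qed

definition low :: "real \<Rightarrow> bool" where
  "low x \<longleftrightarrow> x \<le> 1/2"

definition clique_graphon :: "real \<Rightarrow> real \<Rightarrow> real" where
  "clique_graphon x y = (if low x \<and> low y then 1 else 0)"

definition two_cliques_graphon :: "real \<Rightarrow> real \<Rightarrow> real" where
  "two_cliques_graphon x y = (if low x \<longleftrightarrow> low y then 1 else 0)"

lemma graphon_const: "0 \<le> c \<Longrightarrow> c \<le> 1 \<Longrightarrow> graphon (\<lambda>_ _. c)"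
  by (simp add: graphon_def)

lemma low_measurable [measurable]: "Measurable.pred unit_interval low"
proof -
  have "Measurable.pred borel low" unfolding low_def[abs_def] by measurable
  then show ?thesis by (intro measurable_restrict_space1) simp
qed

lemma graphon_clique: "graphon clique_graphon"
proof -
  have "(\<lambda>(x, y). clique_graphon x y) \<in> borel_measurable (unit_interval \<Otimes>\<^sub>M unit_interval)"
    unfolding clique_graphon_def case_prod_beta' by measurable
  then show ?thesis
    unfolding graphon_def by (rule conjI) (auto simp: clique_graphon_def)
qed

lemma graphon_two_cliques: "graphon two_cliques_graphon"
proof -
  have "(\<lambda>(x, y). two_cliques_graphon x y) \<in> borel_measurable (unit_interval \<Otimes>\<^sub>M unit_interval)"
    unfolding two_cliques_graphon_def case_prod_beta' by measurable
  then show ?thesis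
    unfolding graphon_def by (rule conjI) (auto simp: two_cliques_graphon_def)
qed

lemma hom_density_const: "hom_density G (\<lambda>_ _. c) = c ^ card (snd G)"
  using prob_space.prob_space[OF prob_space_PiM_unit[of "fst G"]] by (simp add: hom_density_def)

lemma integral_halves:
  "(\<integral>t. (if low t then 1 else 0 :: real) \<partial>unit_interval) = 1/2"
  "(\<integral>t. (if low t then 0 else 1 :: real) \<partial>unit_interval) = 1/2"
proof -
  have "(\<integral>t. (if low t then 1 else 0 :: real) \<partial>unit_interval)
      = (\<integral>t. indicator {0..1/2} t \<partial>unit_interval)"
    by (rule Bochner_Integration.integral_cong[OF refl]) (auto simp: space_unit_interval indicator_def low_def)
  also have "\<dots> = measure lborel ({0..1/2} \<inter> {0..1 :: real})"
    by (subst Bochner_Integration.integral_indicator, subst measure_restrict_space)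
      (auto simp: space_unit_interval)
  also have "{0..1/2} \<inter> {0..1} = {0..1/2 :: real}" by auto
  finally show "(\<integral>t. (if low t then 1 else 0 :: real) \<partial>unit_interval) = 1/2" by simp
  have "(\<integral>t. (if low t then 0 else 1 :: real) \<partial>unit_interval)
      = (\<integral>t. indicator {1/2<..1} t \<partial>unit_interval)"
    by (rule Bochner_Integration.integral_cong[OF refl]) (auto simp: space_unit_interval indicator_def low_def)
  also have "\<dots> = measure lborel ({1/2<..1} \<inter> {0..1 :: real})"
    by (subst Bochner_Integration.integral_indicator, subst measure_restrict_space)
      (auto simp: space_unit_interval)
  also have "{1/2<..1} \<inter> {0..1} = {1/2<..1 :: real}" by auto
  finally show "(\<integral>t. (if low t then 0 else 1 :: real) \<partial>unit_interval) = 1/2" by simp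
qed

lemma bmeas_half: "bmeas unit_interval (\<lambda>t. if low t then a else b)"
proof (rule bmeasI[of _ _ "\<bar>a\<bar> + \<bar>b\<bar>"])
  show "(\<lambda>t. if low t then a else b) \<in> borel_measurable unit_interval" by measurable
qed auto

lemma integral_PiM_half:
  assumes "finite V"
  shows "(\<integral>x. (\<Prod>v\<in>V. if low (x v) then 1 else 0 :: real) \<partial>PiM V (\<lambda>_. unit_interval)) = (1/2) ^ card V"
    and "(\<integral>x. (\<Prod>v\<in>V. if low (x v) then 0 else 1 :: real) \<partial>PiM V (\<lambda>_. unit_interval)) = (1/2) ^ card V"
proof -
  interpret prob_space unit_interval by (rule prob_space_unit_interval)
  interpret product_sigma_finite "\<lambda>_. unit_interval" by standard
  show "(\<integral>x. (\<Prod>v\<in>V. if low (x v) then 1 else 0 :: real) \<partial>PiM V (\<lambda>_. unit_interval)) = (1/2) ^ card V"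
    by (subst product_integral_prod) (simp_all add: assms integral_halves bmeas_integrable bmeas_half)
  show "(\<integral>x. (\<Prod>v\<in>V. if low (x v) then 0 else 1 :: real) \<partial>PiM V (\<lambda>_. unit_interval)) = (1/2) ^ card V"
    by (subst product_integral_prod) (simp_all add: assms integral_halves bmeas_integrable bmeas_half)
qed

lemma prod_if_one_zero:
  "finite A \<Longrightarrow> (\<Prod>a\<in>A. if P a then 1 else 0 :: real) = (if \<forall>a\<in>A. P a then 1 else 0)"
  by (induction A rule: finite_induct) auto

lemma finite_edges: "simple_graph G \<Longrightarrow> finite (snd G)"
  by (rule finite_subset[of _ "Pow (fst G)"]) (auto simp: simple_graph_def)

lemma edge_eq_ends:
  assumes "card (e :: nat set) = 2"
  shows "e = {Min e, Max e}"
proof -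
  obtain a b where "e = {a, b}" using assms by (auto simp: card_2_iff)
  then show ?thesis by (cases "a \<le> b") auto
qed

text \<open>Every vertex lies on an edge, so the edge product is 1 exactly when all vertices fall
  into the clique, and these events are independent.\<close>

lemma hom_density_clique:
  assumes G: "simple_graph G" and cover: "\<Union>(snd G) = fst G"
  shows "hom_density G clique_graphon = (1/2) ^ card (fst G)"
proof -
  have fin: "finite (fst G)" using G by (simp add: simple_graph_def)
  have "(\<forall>e\<in>snd G. P (Min e) \<and> P (Max e)) \<longleftrightarrow> (\<forall>v\<in>fst G. P v)" for P
  proof
    assume *: "\<forall>e\<in>snd G. P (Min e) \<and> P (Max e)"
    show "\<forall>v\<in>fst G. P v"
    proof
      fix v assume "v \<in> fst G"
      then obtain e where e: "e \<in> snd G" "v \<in> e" using cover by blast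
      then have "card e = 2" using G by (auto simp: simple_graph_def)
      from e(2) have "v \<in> {Min e, Max e}" by (subst (asm) edge_eq_ends[OF \<open>card e = 2\<close>])
      then show "P v" using * e(1) by blast
    qed
  qed (use edge_ends[OF G] in blast)
  note cover_all = this
  have "(\<Prod>e\<in>snd G. clique_graphon (x (Min e)) (x (Max e))) = (\<Prod>v\<in>fst G. if low (x v) then 1 else 0)" for x
    unfolding clique_graphon_def prod_if_one_zero[OF fin] prod_if_one_zero[OF finite_edges[OF G]]
    by (simp only: cover_all[of "\<lambda>v. low (x v)"])
  then show ?thesis
    unfolding hom_density_def by (simp add: integral_PiM_half[OF fin])
qed

text \<open>Connectedness, stated through predicates constant along edges, forces all vertices into
  the same half; there are two choices of it.\<close>

lemma hom_density_two_cliques: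
  assumes G: "simple_graph G" and nonempty: "fst G \<noteq> {}"
    and connected: "\<And>P. (\<And>e. e \<in> snd G \<Longrightarrow> P (Min e) \<longleftrightarrow> P (Max e)) \<Longrightarrow>
      (\<forall>v\<in>fst G. P v) \<or> (\<forall>v\<in>fst G. \<not> P v)"
  shows "hom_density G two_cliques_graphon = 2 * (1/2) ^ card (fst G)"
proof -
  let ?P = "PiM (fst G) (\<lambda>_. unit_interval)"
  interpret P: prob_space ?P by (rule prob_space_PiM_unit)
  have fin: "finite (fst G)" using G by (simp add: simple_graph_def)
  \<comment> \<open>The two cases exclude each other because there is at least one vertex, so the
    indicator is a sum.\<close>
  have prod: "(\<Prod>e\<in>snd G. two_cliques_graphon (x (Min e)) (x (Max e)))
      = (\<Prod>v\<in>fst G. if low (x v) then 1 else 0) + (\<Prod>v\<in>fst G. if low (x v) then 0 else 1)" for x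
  proof -
    have "(\<forall>e\<in>snd G. low (x (Min e)) \<longleftrightarrow> low (x (Max e)))
        \<longleftrightarrow> (\<forall>v\<in>fst G. low (x v)) \<or> (\<forall>v\<in>fst G. \<not> low (x v))"
      using connected[of "\<lambda>v. low (x v)"] edge_ends[OF G] by blast
    moreover have "(\<Prod>v\<in>fst G. if low (x v) then 0 else 1) = (\<Prod>v\<in>fst G. if \<not> low (x v) then 1 else 0 :: real)"
      by (intro prod.cong) auto
    ultimately show ?thesis
      unfolding two_cliques_graphon_def using nonempty
      by (auto simp: prod_if_one_zero[OF fin] prod_if_one_zero[OF finite_edges[OF G]])
  qed
  have "bmeas ?P (\<lambda>x. \<Prod>v\<in>fst G. if low (x v) then a else b)" for a b
    by (intro bmeas_prod bmeas_compose[OF bmeas_half] measurable_component_singleton)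
  then show ?thesis
    unfolding hom_density_def prod
    by (subst Bochner_Integration.integral_add)
      (simp_all add: P.bmeas_integrable integral_PiM_half[OF fin])
qed

section \<open>Path and cycle densities of the extremal graphons\<close>

lemma path_cover: "l \<ge> 1 \<Longrightarrow> \<Union>(snd (path_graph l)) = {..l}"
proof (induction l rule: nat_induct_at_least)
  case base
  show ?case by (auto simp: path_graph_def)
next
  case (Suc l)
  have "snd (path_graph (Suc l)) = insert {l, Suc l} (snd (path_graph l))"
    by (simp add: path_graph_def lessThan_Suc)
  then show ?case using Suc by (auto simp: atMost_Suc)
qed

lemma path_connected:
  assumes "\<And>e. e \<in> snd (path_graph l) \<Longrightarrow> P (Min e) \<longleftrightarrow> P (Max e)"
  shows "(\<forall>v\<le>l. P v) \<or> (\<forall>v\<le>l. \<not> P v)"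
proof -
  have step: "P i \<longleftrightarrow> P (Suc i)" if "i < l" for i
    using assms[of "{i, Suc i}"] that by (simp add: path_graph_def)
  have "P v \<longleftrightarrow> P 0" if "v \<le> l" for v
    using that by (induction v) (use step in auto)
  then show ?thesis by blast
qed

lemma fst_path: "fst (path_graph l) = {..l}"
  and fst_cycle: "fst (cycle_graph (Suc l)) = {..l}"
  by (simp_all add: path_graph_def cycle_graph_def lessThan_Suc_atMost)

lemma clique_path: "l \<ge> 1 \<Longrightarrow> hom_density (path_graph l) clique_graphon = (1/2) ^ Suc l"
  using hom_density_clique[OF simple_graph_path] path_cover by (simp add: fst_path)

lemma clique_cycle:
  assumes "l \<ge> 2"
  shows "hom_density (cycle_graph (Suc l)) clique_graphon = (1/2) ^ Suc l"
proof -
  have "\<Union>(snd (cycle_graph (Suc l))) = fst (cycle_graph (Suc l))"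
    using path_cover[of l] assms by (auto simp: cycle_edges fst_cycle)
  then show ?thesis
    using hom_density_clique[OF simple_graph_cycle, of "Suc l"] assms by (simp add: fst_cycle)
qed

lemma two_cliques_path: "hom_density (path_graph l) two_cliques_graphon = (1/2) ^ l"
  using hom_density_two_cliques[OF simple_graph_path, of l] path_connected[of l]
  by (simp add: fst_path Ball_def atMost_iff)

lemma two_cliques_cycle:
  assumes "l \<ge> 2"
  shows "hom_density (cycle_graph (Suc l)) two_cliques_graphon = (1/2) ^ l"
  using hom_density_two_cliques[OF simple_graph_cycle, of "Suc l"] path_connected[of l] assms
  by (simp add: fst_cycle Ball_def cycle_edges)

section \<open>The three exponents: upper bounds matched with witnesses\<close>

theorem theorem4p4:
  fixes m n :: nat
  assumes "m \<ge> 1" and "n \<ge> 1"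
  shows "(m > 2 \<longrightarrow>
            (n \<le> m - 1 \<longrightarrow>
               density_domination_exponent (cycle_graph m) (path_graph n)
                 = ennreal ((real n + 1) / real m)) \<and>
            (n \<ge> m - 1 \<longrightarrow>
               density_domination_exponent (cycle_graph m) (path_graph n)
                 = ennreal (real n / (real m - 1)))) \<and>
         (n > 1 \<longrightarrow>
            density_domination_exponent (path_graph m) (cycle_graph (2 * n))
              = ennreal (2 * real n / real m))"
proof (intro conjI impI)
  obtain m' n' where mn': "m = Suc m'" "n = Suc n'"
    using assms by (metis One_nat_def Suc_le_D)
  {
    assume "m > 2"
    then obtain q where q: "m = Suc (Suc q)" "q \<ge> 1"
      using that[of "m - 2"] by simp
    note simple = simple_graph_cycle[of m] simple_graph_path[of n]
    have walk_pos: "0 < hom_density (path_graph n) W" if "kernel unit_interval W d" for W d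
      using hom_density_path[OF that, of n'] kernel.walk_mass_pos[OF that] by (simp add: mn' del: walk.simps)
    {
      assume n: "n \<le> m - 1"
      show "density_domination_exponent (cycle_graph m) (path_graph n) = ennreal ((real n + 1) / real m)"
      proof (rule antisym)
        show "density_domination_exponent (cycle_graph m) (path_graph n) \<le> ennreal ((real n + 1) / real m)"
        proof (rule exponent_le)
          fix W d assume W: "kernel unit_interval W d"
          show "0 < hom_density (path_graph n) W \<and> (real n + 1) / real m * ln (hom_density (cycle_graph m) W)
              \<le> ln (hom_density (path_graph n) W)"
            using walk_pos[OF W] kernel.walk_ge_cyc_short[OF W, of n q] n q
              hom_density_path[OF W, of n'] hom_density_cycle[OF W, of q]
            by (simp add: mn'(2) add.commute del: walk.simps)
        qed (use simple \<open>m > 2\<close> in auto)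
        \<comment> \<open>The clique gives densities \<open>(1/2) ^ m\<close> for the cycle and
          \<open>(1/2) ^ (n + 1)\<close> for the path: one factor per vertex.\<close>
        show "ennreal ((real n + 1) / real m) \<le> density_domination_exponent (cycle_graph m) (path_graph n)"
          using clique_cycle[of "Suc q"] clique_path[of n] q assms
          by (intro exponent_ge[OF graphon_clique, where b = "1/2"])
            (auto simp: powr_realpow[symmetric] add.commute simp del: power_Suc)
      qed
    next
      assume n: "m - 1 \<le> n"
      show "density_domination_exponent (cycle_graph m) (path_graph n) = ennreal (real n / (real m - 1))"
      proof (rule antisym)
        show "density_domination_exponent (cycle_graph m) (path_graph n) \<le> ennreal (real n / (real m - 1))"
        proof (rule exponent_le)
          fix W d assume W: "kernel unit_interval W d"
          show "0 < hom_density (path_graph n) W \<and> real n / (real m - 1) * ln (hom_density (cycle_graph m) W)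
              \<le> ln (hom_density (path_graph n) W)"
            using walk_pos[OF W] kernel.walk_ge_cyc_long[OF W, of q n] n q
              hom_density_path[OF W, of n'] hom_density_cycle[OF W, of q]
            by (simp add: mn'(2) del: walk.simps)
        qed (use simple \<open>m > 2\<close> in auto)
        \<comment> \<open>Two cliques give \<open>(1/2) ^ (m - 1)\<close> and
          \<open>(1/2) ^ n\<close>: the first vertex is free.\<close>
        show "ennreal (real n / (real m - 1)) \<le> density_domination_exponent (cycle_graph m) (path_graph n)"
          using two_cliques_cycle[of "Suc q"] two_cliques_path[of n] q assms
          by (intro exponent_ge[OF graphon_two_cliques, where b = "1/2"])
            (auto simp: powr_realpow[symmetric] simp del: power_Suc)
      qed
    }
  }
  assume "n > 1"
  \<comment> \<open>In this form the cycle density is \<open>cyc_mass (2 * n')\<close>;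
    \<open>n > 1\<close> ensures \<open>2 * n' \<ge> 1\<close>.\<close>
  have cyc: "cycle_graph (2 * n) = cycle_graph (Suc (Suc (2 * n')))" by (simp add: mn')
  have simple: "simple_graph (cycle_graph (2 * n))" "card (snd (cycle_graph (2 * n))) = 2 * n"
    using \<open>n > 1\<close> by (auto intro: simple_graph_cycle card_edges_cycle)
  show "density_domination_exponent (path_graph m) (cycle_graph (2 * n)) = ennreal (2 * real n / real m)"
  proof (rule antisym)
    show "density_domination_exponent (path_graph m) (cycle_graph (2 * n)) \<le> ennreal (2 * real n / real m)"
    proof (rule exponent_le)
      fix W d assume W: "kernel unit_interval W d"
      show "0 < hom_density (cycle_graph (2 * n)) W \<and> 2 * real n / real m * ln (hom_density (path_graph m) W)
          \<le> ln (hom_density (cycle_graph (2 * n)) W)"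
        using kernel.even_cyc_ge_walk[OF W, of n' m'] kernel.cyc_mass_pos[OF W, of "2 * n'"]
          hom_density_path[OF W, of m'] hom_density_cycle[OF W, of "2 * n'"] \<open>n > 1\<close>
        unfolding cyc by (simp add: mn' del: walk.simps)
    qed (use simple simple_graph_path in auto)
    \<comment> \<open>The constant 1/2 gives one factor 1/2 per edge: \<open>m\<close> for the path
      and \<open>2 * n\<close> for the cycle.\<close>
    show "ennreal (2 * real n / real m) \<le> density_domination_exponent (path_graph m) (cycle_graph (2 * n))"
      using simple(2) assms
      by (intro exponent_ge[OF graphon_const[of "1/2"], where b = "1/2"])
        (auto simp: hom_density_const card_edges_path powr_realpow[symmetric])
  qed
qed

end
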